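(* For every constant $\epsilon\in(0,1)$ there exist constants $K,C>0$ (depending only on $\epsilon$) and a computationally efficient (polynomial-time in $n$) randomized mechanism that, for every $n\ge 2$ and every ordinal matching problem instance with $n$ agents and $n$ items, outputs a random matching $M$ of size $\lceil(1-\epsilon)n\rceil$ such that with probability at least $1-n^{-C}$ the following holds simultaneously for all metrics $d$ consistent with the instance: $$\mathrm{cost}_d(M)\ \le\ K(\log n)^2\cdot\mathrm{cost}_d(M_{\mathrm{OPT},d}),$$ where $M_{\mathrm{OPT},d}$ is a minimum-cost perfect matching with respect to $d$. That is, with probability at least $1-1/\mathrm{poly}(n)$, $M$ has distortion $O(\log^2 n)$ with respect to the optimal perfect matching in all metrics consistent with the input preferences.
   Context: Agents $A=\{a_1,\dots,a_n\}$ and items $B=\{b_1,\dots,b_n\}$. A metric is a function $d:(A\cup B)\times(A\cup B)\to\mathbb{R}_{\ge 0}$ with $d(x,x)=0$, $d(x,y)=d(y,x)$ and $d(x,y)\le d(x,z)+d(z,y)$ (distinct points are allowed to be at distance $0$). An ordinal matching problem instance consists of $n$ preference lists, one per agent; each list is a permutation of $B$. A metric $d$ is consistent with the instance if, for every agent $a_i$, whenever $b_j$ appears before $b_k$ in the list of $a_i$ we have $d(a_i,b_j)\le d(a_i,b_k)$. A (not necessarily perfect) matching $M$ is a set of agent-item pairs in which each agent and each item appears at most once; $\mathrm{cost}_d(M)=\sum_{(a,b)\in M}d(a,b)$. A perfect matching has $n$ pairs. A randomized mechanism maps each instance (it sees only the preference lists, not $d$) to a probability distribution over matchings.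
   Formalization: The polynomial-time mechanism also receives the target size ⌈(1-ε)n⌉ as input, since for noncomputable ε no program can compute it; for rational ε the mechanism can compute it itself. *)

theory Defs
  imports "HOL-Probability.Probability" "HOL-Computational_Algebra.Polynomial"
begin

section \<open>Ordinal metric matching\<close>

text \<open>Agents and items are both indexed by \<open>0, \<dots>, n - 1\<close>; the space \<open>A \<union> B\<close> is the
  disjoint sum of the two index sets, with agents \<open>Inl i\<close> and items \<open>Inr j\<close>.\<close>

type_synonym profile = "nat list list"
type_synonym matching = "(nat \<times> nat) set"

text \<open>The list \<open>P ! i\<close> ranks the items for agent \<open>i\<close>, best first.\<close>

definition pref_profile :: "nat \<Rightarrow> profile \<Rightarrow> bool" where
  "pref_profile n P \<longleftrightarrow>
     length P = n \<and> (\<forall>i<n. distinct (P ! i) \<and> set (P ! i) = {..<n})"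

text \<open>Distinct points may be at distance 0, so the
  library locale \<open>Metric_space\<close> does not apply.\<close>

definition metric_on :: "'a set \<Rightarrow> ('a \<Rightarrow> 'a \<Rightarrow> real) \<Rightarrow> bool" where
  "metric_on X d \<longleftrightarrow>
     (\<forall>x\<in>X. \<forall>y\<in>X. d x y \<ge> 0) \<and>
     (\<forall>x\<in>X. d x x = 0) \<and>
     (\<forall>x\<in>X. \<forall>y\<in>X. d x y = d y x) \<and>
     (\<forall>x\<in>X. \<forall>y\<in>X. \<forall>z\<in>X. d x y \<le> d x z + d z y)"

definition consistent :: "nat \<Rightarrow> profile \<Rightarrow> (nat + nat \<Rightarrow> nat + nat \<Rightarrow> real) \<Rightarrow> bool" where
  "consistent n P d \<longleftrightarrow>
     (\<forall>i<n. \<forall>k<n. \<forall>j<k. d (Inl i) (Inr (P ! i ! j)) \<le> d (Inl i) (Inr (P ! i ! k)))"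

definition is_matching :: "nat \<Rightarrow> matching \<Rightarrow> bool" where
  "is_matching n M \<longleftrightarrow> M \<subseteq> {..<n} \<times> {..<n} \<and> inj_on fst M \<and> inj_on snd M"

definition perfect_matching :: "nat \<Rightarrow> matching \<Rightarrow> bool" where
  "perfect_matching n M \<longleftrightarrow> is_matching n M \<and> card M = n"

definition cost :: "(nat + nat \<Rightarrow> nat + nat \<Rightarrow> real) \<Rightarrow> matching \<Rightarrow> real" where
  "cost d M = (\<Sum>(a, b)\<in>M. d (Inl a) (Inr b))"


section \<open>Polynomial-time randomized computation\<close>

text \<open>
  Programs of a structured random-access machine with fair coin flips. Every variable is a
  two-dimensional array of natural numbers, all cells of which are initially 0 except for the
  input; a scalar is the cell \<open>(0, 0)\<close>.

  Every executed command and every evaluated test costs one unit. This unit cost measure agrees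
  with Turing machine time up to a polynomial: a fixed program contains only expressions of bounded
  size, and, as there is no multiplication, after \<open>t\<close> steps every number has at most \<open>O(t)\<close> more
  bits than the input numbers and the program constants.
\<close>

type_synonym vname = string
type_synonym state = "vname \<Rightarrow> nat \<Rightarrow> nat \<Rightarrow> nat"

datatype aexp =
    N nat
  | Cell vname aexp aexp
  | Plus aexp aexp
  | Minus aexp aexp
  | Div aexp aexp
  | Mod aexp aexp

datatype bexp =
    Less aexp aexp
  | Not bexp
  | And bexp bexp

datatype com =
    SKIP
  | Assign vname aexp aexp aexp
  | Flip vname
  | Seq com com
  | If bexp com com
  | While bexp com

fun aval :: "aexp \<Rightarrow> state \<Rightarrow> nat" where
  "aval (N k) s = k"
| "aval (Cell x i j) s = s x (aval i s) (aval j s)"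
| "aval (Plus a b) s = aval a s + aval b s"
| "aval (Minus a b) s = aval a s - aval b s"
| "aval (Div a b) s = aval a s div aval b s"
| "aval (Mod a b) s = aval a s mod aval b s"

fun bval :: "bexp \<Rightarrow> state \<Rightarrow> bool" where
  "bval (Less a b) s \<longleftrightarrow> aval a s < aval b s"
| "bval (Not b) s \<longleftrightarrow> \<not> bval b s"
| "bval (And b c) s \<longleftrightarrow> bval b s \<and> bval c s"

definition store :: "vname \<Rightarrow> nat \<Rightarrow> nat \<Rightarrow> nat \<Rightarrow> state \<Rightarrow> state" where
  "store x i j v s = s(x := (s x)(i := (s x i)(j := v)))"

text \<open>
  \<open>exec c s D\<close>: started in \<open>s\<close>, the command \<open>c\<close> terminates for all outcomes of its coin flips, and
  \<open>D\<close> is the joint distribution of its final state and its running time.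
\<close>

inductive exec :: "com \<Rightarrow> state \<Rightarrow> (state \<times> nat) pmf \<Rightarrow> bool" where
  exec_Skip:
    "exec SKIP s (return_pmf (s, 1))"
| exec_Assign:
    "exec (Assign x i j a) s (return_pmf (store x (aval i s) (aval j s) (aval a s) s, 1))"
| exec_Flip:
    "exec (Flip x) s (map_pmf (\<lambda>b. (store x 0 0 (of_bool b) s, 1)) (bernoulli_pmf (1/2)))"
| exec_Seq:
    "exec c1 s D1 \<Longrightarrow> (\<And>s' t. (s', t) \<in> set_pmf D1 \<Longrightarrow> exec c2 s' (D2 s')) \<Longrightarrow>
     exec (Seq c1 c2) s (bind_pmf D1 (\<lambda>(s', t). map_pmf (\<lambda>(s'', t'). (s'', t + t')) (D2 s')))"
| exec_If:
    "exec (if bval b s then c1 else c2) s D \<Longrightarrow>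
     exec (If b c1 c2) s (map_pmf (\<lambda>(s', t). (s', Suc t)) D)"
| exec_While:
    "exec (If b (Seq c (While b c)) SKIP) s D \<Longrightarrow> exec (While b c) s D"

inductive_cases exec_cases:
  "exec SKIP s D" "exec (Assign x i j a) s D" "exec (Flip x) s D" "exec (Seq c1 c2) s D"
  "exec (If b c1 c2) s D" "exec (While b c) s D"

lemma exec_unique: "exec c s D \<Longrightarrow> exec c s D' \<Longrightarrow> D = D'"
proof (induction arbitrary: D' rule: exec.induct)
  case (exec_Skip s)
  then show ?case by (rule exec_cases(1)) simp
next
  case (exec_Assign x i j a s)
  then show ?case by (rule exec_cases(2)) simp
next
  case (exec_Flip x s)
  then show ?case by (rule exec_cases(3)) simp
next
  case (exec_Seq c1 s D1 c2 D2)
  from exec_Seq.prems show ?case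
  proof (rule exec_cases(4))
    fix D1' D2'
    assume D': "D' = bind_pmf D1' (\<lambda>(s', t). map_pmf (\<lambda>(s'', t'). (s'', t + t')) (D2' s'))"
      and 1: "exec c1 s D1'"
      and 2: "\<And>s' t. (s', t) \<in> set_pmf D1' \<Longrightarrow> exec c2 s' (D2' s')"
    have eq: "D1 = D1'" using exec_Seq.IH(1) 1 by blast
    have "D2 s' = D2' s'" if "(s', t) \<in> set_pmf D1" for s' t
      using exec_Seq.IH(2)[OF that] 2 that eq by blast
    then show ?thesis unfolding D' eq[symmetric]
      by (intro bind_pmf_cong refl) (clarsimp split: prod.splits)
  qed
next
  case (exec_If b s c1 c2 D)
  from exec_If.prems show ?case
    by (rule exec_cases(5)) (use exec_If.IH in blast)
next
  case (exec_While b c s D)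
  from exec_While.prems show ?case
    by (rule exec_cases(6)) (use exec_While.IH in blast)
qed

text \<open>
  Besides \<open>n\<close> and the preference lists, a mechanism is told the number \<open>m\<close> of pairs it has to
  output. For \<open>m = \<lceil>(1 - \<epsilon>) n\<rceil>\<close> with rational \<open>\<epsilon>\<close> it could compute \<open>m\<close> itself, but for a
  noncomputable real \<open>\<epsilon>\<close> no program can.
\<close>

definition input_state :: "nat \<Rightarrow> nat \<Rightarrow> profile \<Rightarrow> state" where
  "input_state n m P = (\<lambda>x i j.
     if x = ''n'' \<and> i = 0 \<and> j = 0 then n
     else if x = ''m'' \<and> i = 0 \<and> j = 0 then m
     else if x = ''pref'' \<and> i < n \<and> j < n then P ! i ! j
     else 0)"

text \<open>In the output array, 0 stands for an unmatched agent and \<open>j + 1\<close> for item \<open>j\<close>.\<close>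

definition output_matching :: "nat \<Rightarrow> state \<Rightarrow> matching" where
  "output_matching n s = {(i, j). i < n \<and> s ''out'' i 0 = Suc j}"

text \<open>One program serves all \<open>n\<close>, and its running time is bounded by a polynomial in \<open>n\<close> for all
  outcomes of the coin flips.\<close>

definition polytime_mechanism :: "(nat \<Rightarrow> nat) \<Rightarrow> (profile \<Rightarrow> matching pmf) \<Rightarrow> bool" where
  "polytime_mechanism m mech \<longleftrightarrow>
     (\<exists>(c :: com) (p :: nat poly). \<forall>n P. pref_profile n P \<longrightarrow>
        (\<exists>D. exec c (input_state n (m n) P) D \<and>
             (\<forall>(s, t)\<in>set_pmf D. t \<le> poly p n) \<and>
             mech P = map_pmf (\<lambda>(s, t). output_matching n s) D))"

end

theory Submission
  imports Defs
begin

text \<open>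
  Give every agent and every item \<open>cap = \<lceil>2 / \<epsilon>\<rceil>\<close> copies. In \<open>cap - 2\<close> round-robin rounds, each
  agent in turn takes a copy of its best item that still has one. A plan for the remaining copies
  that starts as \<open>cap\<close> copies of an optimal matching can be repaired after each pick, and its cost
  grows by a factor of at most \<open>(k - 1) / (k - 2)\<close> in a round that starts with \<open>k\<close> copies per agent.
  Hence all picks together cost at most \<open>cap (cap - 1)\<close> times the optimum, for every consistent
  metric simultaneously. The picks form a bipartite multigraph in which agents have degree \<open>cap - 2\<close>
  and items degree at most \<open>cap\<close>, so it contains a matching that covers all but \<open>2 n / cap \<le> \<epsilon> n\<close>
  agents; an auction finds it. The mechanism is thus deterministic and has constant distortion.
\<close>

section \<open>Round-robin picking with copies\<close>

text \<open>The copies are what makes a greedy pick affordable. Let \<open>k = cap - r\<close> be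
  the number of copies per agent at the start of a round. An agent about to pick still has
  \<open>k\<close> planned partners, and the cheapest of them, at distance \<open>x\<close>,
  accounts for at most \<open>1 / k\<close> of the planned cost of that agent. A repair raises the
  plan cost \<open>W\<close> by at most \<open>x\<close>, but may put up to \<open>2 * x\<close> on
  the agents that have yet to pick in this round. Their planned cost \<open>U\<close> thus loses at
  least \<open>k * x\<close> and gains at most \<open>2 * x\<close>, so
  \<open>(k - 2) * W + U\<close> never increases. It equals \<open>(k - 1) * W\<close> when the
  round starts and \<open>(k - 2) * W\<close> when it ends, which is the factor of the overview. For
  \<open>k = cap, ..., 3\<close> these factors telescope to \<open>cap - 1\<close>. At
  \<open>k = 2\<close> the weight of \<open>W\<close> vanishes and the plan cost is no longer
  controlled; hence two copies per agent stay unpicked, and they are the 2 in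
  \<open>2 n / cap\<close>.\<close>

locale round_robin =
  fixes n cap :: nat and P :: profile
  assumes pref: "pref_profile n P"
begin

text \<open>Pick \<open>t\<close> belongs to agent \<open>t mod n\<close>, so a single index runs
  through all rounds. The chosen item is written out because \<open>rank\<close> and
  \<open>taken\<close> depend on \<open>used\<close>; \<open>used_Suc\<close> is the form to work
  with.\<close>

primrec used :: "nat \<Rightarrow> nat \<Rightarrow> nat" where
  "used 0 = (\<lambda>_. 0)"
| "used (Suc t) =
     (let j = P ! (t mod n) ! (LEAST q. used t (P ! (t mod n) ! q) < cap)
      in (used t)(j := Suc (used t j)))"

definition rank :: "nat \<Rightarrow> nat" where
  "rank t = (LEAST q. used t (P ! (t mod n) ! q) < cap)"

definition taken :: "nat \<Rightarrow> nat" where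
  "taken t = P ! (t mod n) ! rank t"

definition picks :: "nat \<Rightarrow> (nat \<times> nat) set" where
  "picks t = (\<lambda>t. (t mod n, taken t)) ` {..<t}"

lemma used_Suc: "used (Suc t) = (used t)(taken t := Suc (used t (taken t)))"
  by (simp add: taken_def rank_def Let_def)

declare used.simps(2) [simp del]

lemma picks_Suc: "picks (Suc t) = insert (t mod n, taken t) (picks t)"
  by (auto simp: picks_def lessThan_Suc)

lemma pref_list:
  assumes "i < n"
  shows "length (P ! i) = n" "set (P ! i) = {..<n}" "distinct (P ! i)"
proof -
  show "set (P ! i) = {..<n}" "distinct (P ! i)"
    using pref assms by (auto simp: pref_profile_def)
  then show "length (P ! i) = n"
    using distinct_card[of "P ! i"] by simp
qed

lemma item_at_rank:
  assumes "i < n" "j < n"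
  obtains q where "q < n" "P ! i ! q = j"
  using assms pref_list[of i] by (metis in_set_conv_nth lessThan_iff)

lemma rank_le: "used t (P ! (t mod n) ! q) < cap \<Longrightarrow> rank t \<le> q"
  by (simp add: rank_def Least_le)

lemma used_taken_less: "used t (P ! (t mod n) ! q) < cap \<Longrightarrow> used t (taken t) < cap"
  unfolding taken_def rank_def by (rule LeastI)

lemma open_position:
  assumes "(\<Sum>j<n. used t j) = t" "t < cap * n"
  obtains q where "q < n" "used t (P ! (t mod n) ! q) < cap"
proof -
  have "n > 0" using assms by (cases n) auto
  have "\<exists>j<n. used t j < cap"
  proof (rule ccontr)
    assume "\<not> ?thesis"
    then have "(\<Sum>j<n. cap) \<le> (\<Sum>j<n. used t j)"
      by (intro sum_mono) auto
    then show False using assms by (simp add: mult.commute)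
  qed
  then show ?thesis
    using item_at_rank[of "t mod n"] \<open>n > 0\<close> that by (metis mod_less_divisor)
qed

text \<open>The \<open>LEAST\<close> in \<open>rank\<close> is meaningful only while some item has a
  copy left, and that follows from the total number of picks so far. The facts about
  \<open>rank\<close> and \<open>taken\<close> at all times \<open>t < cap * n\<close> therefore
  have to wait for this induction.\<close>

lemma sum_used_and_bound:
  "t \<le> cap * n \<Longrightarrow> (\<Sum>j<n. used t j) = t \<and> (\<forall>j. used t j \<le> cap)"
proof (induction t)
  case (Suc t)
  then have IH: "(\<Sum>j<n. used t j) = t" "\<forall>j. used t j \<le> cap" and t: "t < cap * n"
    by auto
  obtain q where q: "q < n" "used t (P ! (t mod n) ! q) < cap"
    using open_position[OF IH(1) t] .
  have n: "t mod n < n" using q by simp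
  have "rank t < n" using rank_le[OF q(2)] q(1) by simp
  then have taken: "taken t < n"
    using pref_list[OF n] nth_mem[of "rank t" "P ! (t mod n)"] by (simp add: taken_def)
  have "(\<Sum>j<n. used (Suc t) j) = (\<Sum>j<n. used t j + (if j = taken t then 1 else 0))"
    by (intro sum.cong) (auto simp: used_Suc)
  also have "\<dots> = Suc t"
    using taken IH by (simp add: sum.distrib)
  finally show ?case
    using IH(2) used_taken_less[OF q(2)] by (auto simp: used_Suc)
qed simp

lemma used_le: "t \<le> cap * n \<Longrightarrow> used t j \<le> cap"
  using sum_used_and_bound by blast

lemma
  assumes "t < cap * n"
  shows rank_less: "rank t < n"
    and taken_less: "taken t < n"
    and used_taken: "used t (taken t) < cap"
    and used_before_rank: "q < rank t \<Longrightarrow> cap \<le> used t (P ! (t mod n) ! q)"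
proof -
  obtain q' where q: "q' < n" "used t (P ! (t mod n) ! q') < cap"
    using open_position sum_used_and_bound assms by (metis less_imp_le)
  have n: "t mod n < n" using q by simp
  show r: "rank t < n" using rank_le[OF q(2)] q(1) by simp
  then show "taken t < n"
    using pref_list[OF n] nth_mem[of "rank t" "P ! (t mod n)"] by (simp add: taken_def)
  show "used t (taken t) < cap" using used_taken_less[OF q(2)] .
  show "q < rank t \<Longrightarrow> cap \<le> used t (P ! (t mod n) ! q)"
    using rank_le[of t q] by linarith
qed

lemma used_eq_card: "used t j = card {t'. t' < t \<and> taken t' = j}"
proof (induction t)
  case (Suc t)
  have "{t'. t' < Suc t \<and> taken t' = j} =
      (if taken t = j then insert t {t'. t' < t \<and> taken t' = j} else {t'. t' < t \<and> taken t' = j})"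
    by (auto simp: less_Suc_eq)
  then show ?case using Suc by (auto simp: used_Suc)
qed simp

lemma picks_subset:
  assumes "t \<le> cap * n"
  shows "picks t \<subseteq> {..<n} \<times> {..<n}"
proof
  fix e assume "e \<in> picks t"
  then obtain t' where t': "t' < t" "e = (t' mod n, taken t')" by (auto simp: picks_def)
  then have "n > 0" using assms by (cases n) auto
  then show "e \<in> {..<n} \<times> {..<n}" using t' assms taken_less[of t'] by auto
qed

text \<open>Double counting: the agents in \<open>A\<close> make \<open>R * card A\<close> picks in
  the first \<open>R\<close> rounds, all of them land in \<open>B\<close>, and no item is taken more
  than \<open>cap\<close> times. The count is over time indices because the set \<open>picks\<close>
  forgets multiplicities.\<close>

lemma picks_neighbours_card:
  assumes "A \<subseteq> {..<n}" "finite B" "R \<le> cap"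
    and nb: "\<And>i j. (i, j) \<in> picks (R * n) \<Longrightarrow> i \<in> A \<Longrightarrow> j \<in> B"
  shows "R * card A \<le> cap * card B"
proof -
  let ?T = "{t. t < R * n \<and> t mod n \<in> A}"
  let ?f = "\<lambda>(r, i). r * n + i"
  have "inj_on ?f ({..<R} \<times> A)"
  proof (rule inj_onI, clarify)
    fix r i r' i' assume "i \<in> A" "i' \<in> A" and eq: "r * n + i = r' * n + i'"
    then have i: "i < n" "i' < n" using assms(1) by auto
    have "(r * n + i) mod n = i" "(r' * n + i') mod n = i'"
      "(r * n + i) div n = r" "(r' * n + i') div n = r'" using i by auto
    then show "r = r' \<and> i = i'" using eq by metis
  qed
  then have "R * card A = card (?f ` ({..<R} \<times> A))"
    by (simp add: card_image card_cartesian_product)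
  also have "\<dots> \<le> card ?T"
  proof (rule card_mono)
    show "?f ` ({..<R} \<times> A) \<subseteq> ?T"
    proof (rule image_subsetI)
      fix x assume "x \<in> {..<R} \<times> A"
      then obtain r i where x: "x = (r, i)" "i \<in> A" "i < n" "Suc r \<le> R" using assms(1) by auto
      then have "r * n + i < Suc r * n" by simp
      also have "\<dots> \<le> R * n" using x(4) by (rule mult_le_mono1)
      finally show "?f x \<in> ?T" using x by simp
    qed
  qed simp
  also have "\<dots> \<le> card (\<Union>j\<in>B. {t. t < R * n \<and> taken t = j})"
    using nb assms(2) by (intro card_mono) (auto simp: picks_def)
  also have "\<dots> \<le> (\<Sum>j\<in>B. card {t. t < R * n \<and> taken t = j})"
    using assms(2) by (rule card_UN_le)
  also have "\<dots> \<le> (\<Sum>j\<in>B. cap)"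
    using used_le[of "R * n"] assms(3) by (intro sum_mono) (simp flip: used_eq_card)
  finally show ?thesis by (simp add: mult.commute)
qed

end


section \<open>Cost of the picks\<close>

text \<open>The detour from \<open>a'\<close> over \<open>b\<close> and \<open>a\<close> to
  \<open>b'\<close>. The cost argument uses the metric only through these two facts, so distances
  between two items occur nowhere else.\<close>

lemma
  assumes "metric_on (A <+> B) d" "a \<in> A" "b \<in> B"
  shows metric_on_nonneg: "0 \<le> d (Inl a) (Inr b)"
    and metric_on_four_points: "a' \<in> A \<Longrightarrow> b' \<in> B \<Longrightarrow>
      d (Inl a') (Inr b') \<le> d (Inl a') (Inr b) + d (Inl a) (Inr b) + d (Inl a) (Inr b')"
proof -
  note d = assms(1)[unfolded metric_on_def]
  have ab: "Inl a \<in> A <+> B" "Inr b \<in> A <+> B" using assms by auto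
  show "0 \<le> d (Inl a) (Inr b)" using d ab by blast
  assume "a' \<in> A" "b' \<in> B"
  then have ab': "Inl a' \<in> A <+> B" "Inr b' \<in> A <+> B" by auto
  have "d (Inl a') (Inr b') \<le> d (Inl a') (Inr b) + d (Inr b) (Inr b')"
    "d (Inr b) (Inr b') \<le> d (Inr b) (Inl a) + d (Inl a) (Inr b')"
    "d (Inr b) (Inl a) = d (Inl a) (Inr b)"
    using d ab ab' by blast+
  then show "d (Inl a') (Inr b') \<le> d (Inl a') (Inr b) + d (Inl a) (Inr b) + d (Inl a) (Inr b')"
    by linarith
qed

section \<open>Plans as multisets of pairs, and their repair after a pick\<close>

definition agents_cost :: "('a \<times> 'b \<Rightarrow> real) \<Rightarrow> 'a set \<Rightarrow> ('a \<times> 'b) multiset \<Rightarrow> real" where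
  "agents_cost \<delta> S Y = (\<Sum>e\<in>#Y. if fst e \<in> S then \<delta> e else 0)"

lemma agents_cost_simps [simp]:
  "agents_cost \<delta> S {#} = 0"
  "agents_cost \<delta> S (add_mset e Y) = (if fst e \<in> S then \<delta> e else 0) + agents_cost \<delta> S Y"
  by (simp_all add: agents_cost_def)

lemma agents_cost_Un_disjoint:
  "S \<inter> T = {} \<Longrightarrow> agents_cost \<delta> (S \<union> T) Y = agents_cost \<delta> S Y + agents_cost \<delta> T Y"
  by (induction Y) auto

lemma agents_cost_cong:
  "(\<And>e. e \<in># Y \<Longrightarrow> fst e \<in> S \<longleftrightarrow> fst e \<in> T) \<Longrightarrow> agents_cost \<delta> S Y = agents_cost \<delta> T Y"
  by (induction Y) auto

text \<open>Averaging: with \<open>x\<close> the cheapest planned cost of \<open>a\<close>, it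
  bounds \<open>x\<close> by the planned cost of \<open>a\<close> divided by its number of
  copies.\<close>

lemma agents_cost_ge:
  "(\<And>e. e \<in># Y \<Longrightarrow> fst e = a \<Longrightarrow> x \<le> \<delta> e) \<Longrightarrow>
   real (count (image_mset fst Y) a) * x \<le> agents_cost \<delta> {a} Y"
proof (induction Y)
  case (add e Y)
  have "real (count (image_mset fst Y) a) * x \<le> agents_cost \<delta> {a} Y"
    using add.prems by (intro add.IH) auto
  moreover have "fst e = a \<Longrightarrow> x \<le> \<delta> e" using add.prems by simp
  ultimately show ?case by (auto simp: algebra_simps)
qed simp

text \<open>If \<open>a\<close> takes its nearest item \<open>b\<close>, the partner \<open>a'\<close> that the plan \<open>Y\<close> gave to \<open>b\<close>
  inherits the cheapest partner of \<open>a\<close>. If a copy of \<open>a\<close> is planned to use \<open>b\<close> itself, no repair is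
  needed.\<close>

lemma plan_exchange:
  assumes a: "a \<in># image_mset fst Y" and b: "b \<in># image_mset snd Y"
    and nearest: "\<And>b'. (a, b') \<in># Y \<Longrightarrow> \<delta> (a, b) \<le> \<delta> (a, b')"
    and nonneg: "0 \<le> \<delta> (a, b)"
    and four: "\<And>a' b'. (a', b) \<in># Y \<Longrightarrow> (a, b') \<in># Y \<Longrightarrow>
      \<delta> (a', b') \<le> \<delta> (a', b) + \<delta> (a, b) + \<delta> (a, b')"
  obtains Y' x where
    "image_mset fst Y = add_mset a (image_mset fst Y')"
    "image_mset snd Y = add_mset b (image_mset snd Y')"
    "set_mset Y' \<subseteq> fst ` set_mset Y \<times> snd ` set_mset Y"
    "\<delta> (a, b) \<le> x" "real (count (image_mset fst Y) a) * x \<le> agents_cost \<delta> {a} Y"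
    "agents_cost \<delta> UNIV Y' \<le> agents_cost \<delta> UNIV Y + x"
    "\<And>T. a \<notin> T \<Longrightarrow> agents_cost \<delta> T Y' \<le> agents_cost \<delta> T Y + 2 * x"
proof (cases "(a, b) \<in># Y")
  case True
  then obtain Z where Z: "Y = add_mset (a, b) Z" by (metis mset_add)
  show ?thesis
  \<comment> \<open>By \<open>nearest\<close>, \<open>b\<close> is here itself a cheapest planned
    partner of \<open>a\<close>, and dropping the pair leaves all other agents untouched.\<close>
  proof (rule that[of Z "\<delta> (a, b)"])
    show "real (count (image_mset fst Y) a) * \<delta> (a, b) \<le> agents_cost \<delta> {a} Y"
      using nearest by (intro agents_cost_ge) auto
    show "set_mset Z \<subseteq> fst ` set_mset Y \<times> snd ` set_mset Y"
      using Z by force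
  qed (use Z nonneg in auto)
next
  case False
  obtain e where e: "e \<in># Y" "fst e = a" using a by auto
  let ?S = "{e \<in> set_mset Y. fst e = a}"
  have S: "finite ?S" "?S \<noteq> {}" using e by fastforce+
  define e0 where "e0 = arg_min_on \<delta> ?S"
  have e0: "e0 \<in> ?S" "\<And>e. e \<in> ?S \<Longrightarrow> \<delta> e0 \<le> \<delta> e"
    using arg_min_if_finite(1)[OF S] arg_min_least[OF S] unfolding e0_def by blast+
  define b' where "b' = snd e0"
  have ab': "(a, b') \<in># Y" using e0(1) by (auto simp: b'_def)
  obtain a' where a'b: "(a', b) \<in># Y" using b by auto
  have ne: "b' \<noteq> b" "a' \<noteq> a" using False ab' a'b by auto
  then obtain Z where Z: "Y = add_mset (a, b') (add_mset (a', b) Z)"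
    using ab' a'b by (metis insert_noteq_member mset_add prod.inject)
  have near: "\<delta> (a, b) \<le> \<delta> (a, b')" using nearest ab' .
  have four': "\<delta> (a', b') \<le> \<delta> (a', b) + \<delta> (a, b) + \<delta> (a, b')" using four a'b ab' .
  show ?thesis
  \<comment> \<open>By \<open>four'\<close> the new pair exceeds the two removed ones by at most
    \<open>\<delta> (a, b)\<close>, which is at most \<open>x\<close>. Seen by the agents other than
    \<open>a\<close>, only \<open>(a', b)\<close> is removed, so their cost grows by at most
    \<open>\<delta> (a, b) + \<delta> (a, b')\<close>, hence by at most
    \<open>2 * x\<close>.\<close>
  proof (rule that[of "add_mset (a', b') Z" "\<delta> (a, b')"])
    show "real (count (image_mset fst Y) a) * \<delta> (a, b') \<le> agents_cost \<delta> {a} Y"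
      using e0 by (intro agents_cost_ge) (auto simp: b'_def)
    show "set_mset (add_mset (a', b') Z) \<subseteq> fst ` set_mset Y \<times> snd ` set_mset Y"
      using Z by force
  qed (use Z near four' nonneg ne in auto)
qed

section \<open>Amortised cost of the picks over all rounds\<close>

context round_robin
begin

lemma taken_nearest:
  assumes "consistent n P d" "t < cap * n" "j < n" "used t j < cap"
  shows "d (Inl (t mod n)) (Inr (taken t)) \<le> d (Inl (t mod n)) (Inr j)"
proof -
  have n: "t mod n < n" using assms by simp
  obtain q where q: "q < n" "P ! (t mod n) ! q = j" using item_at_rank[OF n assms(3)] .
  have "rank t \<le> q" using rank_le[of t q] q assms(4) by simp
  \<comment> \<open>\<open>consistent\<close> compares only distinct positions, so equality is a
    case of its own.\<close>
  then consider "rank t = q" | "rank t < q" by linarith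
  then show ?thesis
    using assms(1) n q by cases (auto simp: taken_def consistent_def)
qed

definition picks_cost :: "(nat + nat \<Rightarrow> nat + nat \<Rightarrow> real) \<Rightarrow> nat \<Rightarrow> real" where
  "picks_cost d t = (\<Sum>t'<t. d (Inl (t' mod n)) (Inr (taken t')))"

abbreviation pair_cost :: "(nat + nat \<Rightarrow> nat + nat \<Rightarrow> real) \<Rightarrow> nat \<times> nat \<Rightarrow> real" where
  "pair_cost d \<equiv> \<lambda>(a, b). d (Inl a) (Inr b)"

text \<open>\<open>Y\<close> is a plan that assigns the remaining copies of the items to the remaining copies of the
  agents after \<open>r\<close> full rounds and the picks of agents \<open>0, \<dots>, i - 1\<close> in the next round. The
  linear potentials absorb that repairing the plan may shift cost to agents that are still to pick
  in this round.\<close>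

definition plan_inv ::
    "(nat + nat \<Rightarrow> nat + nat \<Rightarrow> real) \<Rightarrow> real \<Rightarrow> nat \<Rightarrow> nat \<Rightarrow> (nat \<times> nat) multiset \<Rightarrow> bool" where
  "plan_inv d C r i Y \<longleftrightarrow>
     set_mset Y \<subseteq> {..<n} \<times> {..<n} \<and>
     (\<forall>a<n. count (image_mset fst Y) a = (cap - r) - of_bool (a < i)) \<and>
     (\<forall>b<n. count (image_mset snd Y) b = cap - used (r * n + i) b) \<and>
     (real cap - real r - 2) * agents_cost (pair_cost d) UNIV Y
       + agents_cost (pair_cost d) {i..} Y \<le> C \<and>
     (real cap - real r - 2) * picks_cost d (r * n + i)
       + agents_cost (pair_cost d) {i..} Y \<le> C"

text \<open>When agent \<open>i\<close> picks, the cost of the agents still to pick falls by at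
  least \<open>(k - 2) * x\<close>, where \<open>k = cap - r\<close>. In the first potential this
  pays for the growth of the plan cost, in the second for the pick itself: both are at most
  \<open>x\<close> and carry the weight \<open>k - 2\<close>.\<close>

lemma plan_inv_step:
  assumes d: "metric_on ({..<n} <+> {..<n}) d" "consistent n P d"
    and r: "r + 2 < cap" and i: "i < n" and inv: "plan_inv d C r i Y"
  obtains Y' where "plan_inv d C r (Suc i) Y'"
proof -
  let ?t = "r * n + i" and ?\<delta> = "pair_cost d"
  let ?b = "taken ?t" and ?k = "real cap - real r"
  have mod: "?t mod n = i" using i by simp
  have "?t < Suc r * n" using i by simp
  also have "\<dots> \<le> cap * n" using r by (intro mult_le_mono1) simp
  finally have t: "?t < cap * n" .
  have b: "?b < n" using taken_less[OF t] .
  note inv' = inv[unfolded plan_inv_def]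
  have Y: "set_mset Y \<subseteq> {..<n} \<times> {..<n}"
    and cf: "\<And>a. a < n \<Longrightarrow> count (image_mset fst Y) a = (cap - r) - of_bool (a < i)"
    and cs: "\<And>b. b < n \<Longrightarrow> count (image_mset snd Y) b = cap - used ?t b"
    using inv' by auto
  have ci: "real (count (image_mset fst Y) i) = ?k" using cf[OF i] r by simp
  have open_item: "used ?t b' < cap" if "(a, b') \<in># Y" for a b'
  proof -
    have "b' \<in># image_mset snd Y" "b' < n" using that Y by force+
    then have "count (image_mset snd Y) b' > 0" by simp
    then show ?thesis using cs[OF \<open>b' < n\<close>] by simp
  qed
  have nonneg: "0 \<le> ?\<delta> (i, ?b)"
    using metric_on_nonneg[OF d(1)] i b by simp
  have four: "?\<delta> (a', b') \<le> ?\<delta> (a', ?b) + ?\<delta> (i, ?b) + ?\<delta> (i, b')"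
    if "(a', ?b) \<in># Y" "(i, b') \<in># Y" for a' b'
    using metric_on_four_points[OF d(1), of i ?b a' b'] i b that Y by auto
  obtain Y' x where Y':
    "image_mset fst Y = add_mset i (image_mset fst Y')"
    "image_mset snd Y = add_mset ?b (image_mset snd Y')"
    "set_mset Y' \<subseteq> fst ` set_mset Y \<times> snd ` set_mset Y"
    and x: "?\<delta> (i, ?b) \<le> x" "real (count (image_mset fst Y) i) * x \<le> agents_cost ?\<delta> {i} Y"
    and W: "agents_cost ?\<delta> UNIV Y' \<le> agents_cost ?\<delta> UNIV Y + x"
    and U: "\<And>T. i \<notin> T \<Longrightarrow> agents_cost ?\<delta> T Y' \<le> agents_cost ?\<delta> T Y + 2 * x"
  proof (rule plan_exchange[of i Y ?b ?\<delta>])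
    have "count (image_mset fst Y) i > 0" using cf[OF i] r by simp
    then show "i \<in># image_mset fst Y" by (rule count_greater_zero_iff[THEN iffD1])
    have "count (image_mset snd Y) ?b > 0" using cs[OF b] used_taken[OF t] by simp
    then show "?b \<in># image_mset snd Y" by (rule count_greater_zero_iff[THEN iffD1])
    show "?\<delta> (i, ?b) \<le> ?\<delta> (i, b')" if "(i, b') \<in># Y" for b'
      using taken_nearest[OF d(2) t _ open_item[OF that]] that Y mod by auto
  qed (use nonneg four in blast)+
  have "{i..} = {i} \<union> {Suc i..}" by auto
  then have split: "agents_cost ?\<delta> {i..} Y = agents_cost ?\<delta> {i} Y + agents_cost ?\<delta> {Suc i..} Y"
    using agents_cost_Un_disjoint[of "{i}" "{Suc i..}" ?\<delta> Y] by simp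
  have U': "agents_cost ?\<delta> {Suc i..} Y' + (?k - 2) * x \<le> agents_cost ?\<delta> {i..} Y"
    using U[of "{Suc i..}"] x(2) split ci by (simp add: algebra_simps)
  have k: "?k - 2 \<ge> 0" using r by linarith
  have X: "picks_cost d (r * n + Suc i) = picks_cost d ?t + ?\<delta> (i, ?b)"
    using mod by (simp add: picks_cost_def)
  have "plan_inv d C r (Suc i) Y'"
    unfolding plan_inv_def
  proof (intro conjI allI impI)
    show "set_mset Y' \<subseteq> {..<n} \<times> {..<n}"
      using Y'(3) Y by fastforce
    show "count (image_mset fst Y') a = cap - r - of_bool (a < Suc i)" if "a < n" for a
      using cf[OF that] arg_cong[OF Y'(1), of "\<lambda>M. count M a"] by (auto simp: less_Suc_eq)
    show "count (image_mset snd Y') b' = cap - used (r * n + Suc i) b'" if "b' < n" for b'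
      using cs[OF that] arg_cong[OF Y'(2), of "\<lambda>M. count M b'"] by (auto simp: used_Suc)
    have "(?k - 2) * agents_cost ?\<delta> UNIV Y' \<le> (?k - 2) * (agents_cost ?\<delta> UNIV Y + x)"
      using W k by (rule mult_left_mono)
    then show "(?k - 2) * agents_cost ?\<delta> UNIV Y' + agents_cost ?\<delta> {Suc i..} Y' \<le> C"
      using inv' U' by (simp add: distrib_left)
    have "(?k - 2) * picks_cost d (r * n + Suc i) \<le> (?k - 2) * (picks_cost d ?t + x)"
      using X x(1) k by (intro mult_left_mono) auto
    then show "(?k - 2) * picks_cost d (r * n + Suc i) + agents_cost ?\<delta> {Suc i..} Y' \<le> C"
      using inv' U' by (simp add: distrib_left)
  qed
  then show ?thesis by (rule that)
qed

text \<open>At the end of a round nobody is left to pick, so \<open>p * W\<close> and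
  \<open>p * X\<close> are both at most \<open>C\<close> for the weight \<open>p\<close>. The new
  weight is \<open>p - 1\<close> and all agents are pending again. Then
  \<open>(p - 1) * W + W\<close> is \<open>p * W\<close>, and \<open>(p - 1) * X + W\<close> is a
  convex combination of \<open>p * X\<close> and \<open>p * W\<close>. Hence the same
  \<open>C\<close> serves all rounds.\<close>

lemma plan_inv_next_round:
  assumes r: "r + 2 < cap" and inv: "plan_inv d C r n Y"
  shows "plan_inv d C (Suc r) 0 Y"
proof -
  let ?\<delta> = "pair_cost d"
  let ?p = "real cap - real r - 2"
  let ?W = "agents_cost ?\<delta> UNIV Y" and ?X = "picks_cost d (r * n + n)"
  note inv' = inv[unfolded plan_inv_def]
  have "agents_cost ?\<delta> {n..} Y = agents_cost ?\<delta> {} Y"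
    using inv' by (intro agents_cost_cong) auto
  also have "\<dots> = 0" by (simp add: agents_cost_def)
  finally have W: "?p * ?W \<le> C" and X: "?p * ?X \<le> C" using inv' by auto
  have p: "?p \<ge> 1" using r by linarith
  have "(?p - 1) * (?p * ?X) \<le> (?p - 1) * C"
    using X p by (intro mult_left_mono) auto
  then have "?p * ((?p - 1) * ?X + ?W) \<le> ?p * C"
    using W by (simp add: algebra_simps)
  then have "(?p - 1) * ?X + ?W \<le> C" using p by simp
  moreover have "(?p - 1) * ?W + ?W \<le> C" using W by (simp add: algebra_simps)
  moreover have "Suc r * n + 0 = r * n + n" by simp
  moreover have "real cap - real (Suc r) - 2 = ?p - 1"
    "{0::nat..} = UNIV" by auto
  moreover have "of_bool (a < n) = (1::nat)" if "a < n" for a using that by simp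
  ultimately show ?thesis using inv' unfolding plan_inv_def by (simp only: ) simp
qed

lemma plan_inv_reachable:
  assumes d: "metric_on ({..<n} <+> {..<n}) d" "consistent n P d"
    and inv: "plan_inv d C 0 0 Y"
  shows "r + 2 < cap \<Longrightarrow> i \<le> n \<Longrightarrow> \<exists>Y. plan_inv d C r i Y"
proof (induction r arbitrary: i)
  case 0
  note r = 0(1)
  from 0(2) show ?case
  proof (induction i)
    case (Suc i)
    then obtain Y' where "plan_inv d C 0 i Y'" by auto
    then show ?case using plan_inv_step[OF d r] Suc.prems by (metis Suc_le_eq)
  qed (use inv in blast)
next
  case (Suc r)
  note r = Suc.prems(1)
  obtain Y where "plan_inv d C r n Y" using Suc.IH[of n] r by auto
  then have start: "plan_inv d C (Suc r) 0 Y"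
    using plan_inv_next_round r by simp
  from Suc.prems(2) show ?case
  proof (induction i)
    case (Suc i)
    then obtain Y' where "plan_inv d C (Suc r) i Y'" by auto
    then show ?case using plan_inv_step[OF d r] Suc.prems by (metis Suc_le_eq)
  qed (use start in blast)
qed

lemma picks_cost_le:
  assumes d: "metric_on ({..<n} <+> {..<n}) d" "consistent n P d"
    and M: "perfect_matching n M" and cap: "cap \<ge> 3"
  shows "picks_cost d ((cap - 2) * n) \<le> (real cap - 1) * real cap * cost d M"
proof -
  let ?\<delta> = "pair_cost d"
  let ?Y = "repeat_mset cap (mset_set M)" and ?C = "(real cap - 1) * real cap * cost d M"
  have sub: "M \<subseteq> {..<n} \<times> {..<n}" and inj: "inj_on fst M" "inj_on snd M" and card: "card M = n"
    using M by (auto simp: perfect_matching_def is_matching_def)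
  have fin: "finite M" using sub finite_subset by blast
  have "fst ` M = {..<n}" "snd ` M = {..<n}"
    using sub card inj by (intro card_subset_eq; force simp: card_image)+
  then have img: "image_mset fst (mset_set M) = mset_set {..<n}"
    "image_mset snd (mset_set M) = mset_set {..<n}"
    using inj by (simp_all add: image_mset_mset_set)
  have rep: "image_mset f (repeat_mset k A) = repeat_mset k (image_mset f A)"
    for f :: "nat \<times> nat \<Rightarrow> nat" and k A by (induction k) auto
  have "agents_cost ?\<delta> UNIV (repeat_mset k (mset_set M)) = real k * cost d M" for k
    using fin by (induction k)
      (auto simp: agents_cost_def cost_def algebra_simps sum_unfold_sum_mset split_def)
  then have W: "agents_cost ?\<delta> UNIV ?Y = real cap * cost d M" .
  moreover have "{0::nat..} = UNIV" by auto
  moreover have "cost d M \<ge> 0"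
    unfolding cost_def using sub d(1) by (intro sum_nonneg) (auto intro: metric_on_nonneg[OF d(1)])
  \<comment> \<open>Initially the first potential equals \<open>C\<close>. The second one is just
    the plan cost, as nothing has been picked yet, and needs this inequality.\<close>
  then have "real cap * cost d M * 1 \<le> real cap * cost d M * (real cap - 1)"
    using cap by (intro mult_left_mono) auto
  moreover have "e \<in> M" if "e \<in># ?Y" for e
    using that fin by (simp add: count_greater_zero_iff[symmetric])
  then have "set_mset ?Y \<subseteq> {..<n} \<times> {..<n}" using sub by blast
  ultimately have "plan_inv d ?C 0 0 ?Y"
    unfolding plan_inv_def using fin
    by (auto simp: rep img picks_cost_def algebra_simps)
  \<comment> \<open>Round \<open>cap - 3\<close> is the last one, and its weight is 1, so the second
    potential bounds the cost of the picks directly by \<open>C\<close>.\<close>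
  then obtain Y where "plan_inv d ?C (cap - 3) n Y"
    using plan_inv_reachable[OF d, of ?C ?Y "cap - 3" n] cap by fastforce
  then have inv: "(real cap - real (cap - 3) - 2) * picks_cost d ((cap - 3) * n + n)
       + agents_cost ?\<delta> {n..} Y \<le> ?C" and Y: "set_mset Y \<subseteq> {..<n} \<times> {..<n}"
    by (auto simp: plan_inv_def)
  have "agents_cost ?\<delta> {n..} Y = agents_cost ?\<delta> {} Y"
    using Y by (intro agents_cost_cong) auto
  also have "\<dots> = 0" by (simp add: agents_cost_def)
  finally have "agents_cost ?\<delta> {n..} Y = 0" .
  moreover have "real cap - real (cap - 3) - 2 = 1" using cap by simp
  moreover have "cap - 2 = Suc (cap - 3)" using cap by simp
  then have "(cap - 3) * n + n = (cap - 2) * n" by simp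
  ultimately show ?thesis using inv by simp
qed

text \<open>A pair picked several times is paid for each time on the right but occurs at most once
  in \<open>M\<close>.\<close>

lemma cost_le_picks_cost:
  assumes "metric_on ({..<n} <+> {..<n}) d" "M \<subseteq> picks t" "t \<le> cap * n"
  shows "cost d M \<le> picks_cost d t"
proof -
  have nonneg: "pair_cost d e \<ge> 0" if "e \<in> picks t" for e
    using that picks_subset[OF assms(3)] by (auto intro: metric_on_nonneg[OF assms(1)])
  have "cost d M \<le> (\<Sum>e\<in>picks t. pair_cost d e)"
    unfolding cost_def using assms(2) nonneg by (intro sum_mono2) (auto simp: picks_def)
  also have "\<dots> \<le> (\<Sum>t'<t. pair_cost d (t' mod n, taken t'))"
    unfolding picks_def using nonneg
    by (intro order.trans[OF sum_image_le]) (auto simp: picks_def comp_def)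
  finally show ?thesis by (simp add: picks_cost_def)
qed

end


section \<open>Matching by auction\<close>

text \<open>\<open>neighbours_card\<close> is Hall's condition weakened by the factor
  \<open>R / cap\<close>, so a perfect matching need not exist. Prices serve as certificates: the
  last clause of \<open>priced_matching\<close> is complementary slackness up to one unit, and by
  the third clause every item of positive price is owned.\<close>

locale auction =
  fixes n cap R :: nat and E :: "(nat \<times> nat) set"
  assumes edges: "E \<subseteq> {..<n} \<times> {..<n}"
    and R_le_cap: "R \<le> cap"
    and neighbours_card: "\<And>A B. A \<subseteq> {..<n} \<Longrightarrow> finite B \<Longrightarrow>
      (\<And>i j. (i, j) \<in> E \<Longrightarrow> i \<in> A \<Longrightarrow> j \<in> B) \<Longrightarrow> R * card A \<le> cap * card B"
begin

text \<open>As in the output array, \<open>out i = Suc j\<close> and \<open>own j = Suc i\<close> encode that \<open>i\<close> holds \<open>j\<close>, and 0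
  stands for unmatched.\<close>

definition priced_matching :: "(nat \<Rightarrow> nat) \<Rightarrow> (nat \<Rightarrow> nat) \<Rightarrow> (nat \<Rightarrow> nat) \<Rightarrow> bool" where
  "priced_matching out own pr \<longleftrightarrow>
     (\<forall>i<n. \<forall>j. out i = Suc j \<longrightarrow> (i, j) \<in> E \<and> own j = Suc i) \<and>
     (\<forall>j<n. \<forall>i. own j = Suc i \<longrightarrow> i < n \<and> out i = Suc j) \<and>
     (\<forall>j<n. own j = 0 \<longrightarrow> pr j = 0) \<and>
     (\<forall>i<n. \<forall>j j'. out i = Suc j \<longrightarrow> (i, j') \<in> E \<longrightarrow> pr j \<le> Suc (pr j'))"

lemma priced_matchingD:
  assumes "priced_matching out own pr"
  shows "i < n \<Longrightarrow> out i = Suc j \<Longrightarrow> (i, j) \<in> E \<and> own j = Suc i \<and> j < n"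
    and "j < n \<Longrightarrow> own j = Suc i \<Longrightarrow> i < n \<and> out i = Suc j"
    and "j < n \<Longrightarrow> own j = 0 \<Longrightarrow> pr j = 0"
    and "i < n \<Longrightarrow> out i = Suc j \<Longrightarrow> (i, j') \<in> E \<Longrightarrow> pr j \<le> Suc (pr j')"
proof -
  note conj = assms[unfolded priced_matching_def]
  show "i < n \<Longrightarrow> out i = Suc j \<Longrightarrow> (i, j) \<in> E \<and> own j = Suc i \<and> j < n"
    using conj[THEN conjunct1, rule_format, of i j] edges by auto
  show "j < n \<Longrightarrow> own j = Suc i \<Longrightarrow> i < n \<and> out i = Suc j"
    using conj[THEN conjunct2, THEN conjunct1, rule_format, of j i] .
  show "j < n \<Longrightarrow> own j = 0 \<Longrightarrow> pr j = 0"
    using conj[THEN conjunct2, THEN conjunct2, THEN conjunct1, rule_format, of j] .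
  show "i < n \<Longrightarrow> out i = Suc j \<Longrightarrow> (i, j') \<in> E \<Longrightarrow> pr j \<le> Suc (pr j')"
    using conj[THEN conjunct2, THEN conjunct2, THEN conjunct2, rule_format, of i j j'] .
qed

text \<open>If all items reachable by free agents cost more than \<open>n\<close>, then the number of items of price at
  least \<open>s\<close> strictly decreases for \<open>s = 0, \<dots>, n + 1\<close>, unless few agents are free.\<close>

lemma free_agents_card_le:
  assumes M: "priced_matching out own pr"
    and high: "\<And>i j. i < n \<Longrightarrow> out i = 0 \<Longrightarrow> (i, j) \<in> E \<Longrightarrow> n < pr j"
  shows "cap * card {i. i < n \<and> out i = 0} \<le> (cap - R) * n"
proof (rule ccontr)
  define F where "F = {i. i < n \<and> out i = 0}"
  define B where "B s = {j. j < n \<and> s \<le> pr j}" for s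
  assume "\<not> ?thesis"
  then have many: "(cap - R) * n < cap * card F" by (simp add: F_def)
  have finB: "finite (B s)" for s by (simp add: B_def)
  have less: "card (B (Suc s)) < card (B s)" if "s \<le> n" for s
  proof (rule ccontr)
    assume "\<not> ?thesis"
    then have le: "card (B s) \<le> card (B (Suc s))" by simp
    \<comment> \<open>\<open>H\<close> consists of the owners of the items of price at least
      \<open>s + 1\<close>. The neighbours of \<open>H\<close> cost at least \<open>s\<close> by
      slackness, those of \<open>F\<close> cost more than \<open>n\<close>, so all neighbours of
      \<open>F \<union> H\<close> lie in \<open>B s\<close>.\<close>
    define H where "H = (\<lambda>j. own j - 1) ` B (Suc s)"
    have own: "\<exists>i<n. own j = Suc i \<and> out i = Suc j" if "j \<in> B (Suc s)" for j
    proof -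
      have j: "j < n" "pr j \<noteq> 0" using that by (auto simp: B_def)
      then have "own j \<noteq> 0" using priced_matchingD(3)[OF M j(1)] j(2) by blast
      then obtain i where "own j = Suc i" using not0_implies_Suc by blast
      then show ?thesis using priced_matchingD(2)[OF M j(1)] by blast
    qed
    have "inj_on (\<lambda>j. own j - 1) (B (Suc s))"
      using own by (intro inj_onI) (metis diff_Suc_1 old.nat.inject)
    then have cardO: "card H = card (B (Suc s))" unfolding H_def by (rule card_image)
    have O: "i < n \<and> out i \<noteq> 0" if i: "i \<in> H" for i
    proof -
      obtain j where "j \<in> B (Suc s)" "i = own j - 1" using i unfolding H_def by (rule imageE)
      then show ?thesis using own[of j] by auto
    qed
    then have "F \<inter> H = {}" unfolding F_def by blast
    moreover have finF: "finite F" by (simp add: F_def)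
    ultimately have card: "card (F \<union> H) = card F + card (B (Suc s))"
      using cardO finB[of "Suc s"] by (subst card_Un_disjoint) (auto simp: H_def)
    have sub: "F \<union> H \<subseteq> {..<n}" using O unfolding F_def by blast
    have "R * card (F \<union> H) \<le> cap * card (B s)"
    proof (rule neighbours_card[OF sub finB])
      fix i j assume ij: "(i, j) \<in> E" "i \<in> F \<union> H"
      then have "j < n" using edges by auto
      moreover have "s \<le> pr j"
      proof (cases "i \<in> F")
        case True
        then show ?thesis using high[of i j] ij that by (simp add: F_def)
      next
        case False
        then obtain j' where j': "j' \<in> B (Suc s)" "i = own j' - 1" using ij by (auto simp: H_def)
        then have "i < n" "out i = Suc j'" using own[of j'] by auto
        then have "pr j' \<le> Suc (pr j)" using priced_matchingD(4)[OF M _ _ ij(1)] by simp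
        then show ?thesis using j' by (simp add: B_def)
      qed
      ultimately show "j \<in> B s" by (simp add: B_def)
    qed
    also have "\<dots> \<le> cap * card (B (Suc s))" using le by simp
    finally have 1: "R * card F + R * card (B (Suc s)) \<le> cap * card (B (Suc s))"
      by (simp add: card distrib_left)
    have "card F + card (B (Suc s)) \<le> n"
      using card card_mono[OF _ sub] by simp
    then have "(cap - R) * (card F + card (B (Suc s))) \<le> (cap - R) * n" by (rule mult_le_mono2)
    also note many
    finally have 2: "(cap - R) * card F + (cap - R) * card (B (Suc s)) < cap * card F"
      by (simp add: distrib_left)
    \<comment> \<open>Adding facts 1 and 2 yields \<open>cap * (card F + card (B (Suc s)))\<close>
      on both sides of a strict inequality.\<close>
    have "cap = (cap - R) + R" using R_le_cap by simp
    then have "cap * x = (cap - R) * x + R * x" for x by (metis distrib_right)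
    then show False using 1 2 by (metis add_le_cancel_right add_less_cancel_left leD add.commute)
  qed
  \<comment> \<open>The \<open>n + 1\<close> strict drops force at least \<open>n + 1\<close> items
    into \<open>B 0\<close>, but only \<open>n\<close> exist.\<close>
  have "s \<le> card (B (Suc n - s))" if "s \<le> Suc n" for s
    using that
  proof (induction s)
    case (Suc s)
    then have "card (B (Suc n - s)) < card (B (n - s))"
      using less[of "n - s"] by (simp add: Suc_diff_le)
    then show ?case using Suc by simp
  qed simp
  from this[of "Suc n"] have "Suc n \<le> card (B 0)" by simp
  moreover have "card (B 0) \<le> card {..<n}" by (rule card_mono) (auto simp: B_def)
  ultimately show False by simp
qed

text \<open>Slackness survives because \<open>j\<close> is a cheapest neighbour of \<open>i\<close>
  before its price rises by one, and for the other matched agents only the price of an alternative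
  can rise. If \<open>j\<close> had an owner, that agent becomes free while \<open>i\<close> gets
  matched, so the size grows only when \<open>j\<close> was unowned.\<close>

lemma bid:
  assumes M: "priced_matching out own pr"
    and i: "i < n" "out i = 0" and e: "(i, j) \<in> E"
    and least: "\<And>i' j'. i' < n \<Longrightarrow> out i' = 0 \<Longrightarrow> (i', j') \<in> E \<Longrightarrow> pr j \<le> pr j'"
    and out': "out' = (if own j = 0 then out else out(own j - 1 := 0))(i := Suc j)"
  shows "priced_matching out' (own(j := Suc i)) (pr(j := Suc (pr j)))" (is ?valid)
    and "card {i. i < n \<and> out' i \<noteq> 0} = card {i. i < n \<and> out i \<noteq> 0} + of_bool (own j = 0)" (is ?card)
proof -
  have j: "j < n" using e edges by auto
  note M1 = priced_matchingD(1)[OF M] and M2 = priced_matchingD(2)[OF M]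
    and M3 = priced_matchingD(3)[OF M] and M4 = priced_matchingD(4)[OF M]
  have other: "out' i' = Suc j' \<longleftrightarrow> out i' = Suc j' \<and> j' \<noteq> j" if "i' < n" "i' \<noteq> i" for i' j'
  proof (cases "own j")
    case 0
    then have "out' i' = out i'" using that out' by simp
    moreover have "out i' \<noteq> Suc j" using M1[OF that(1), of j] 0 by auto
    ultimately show ?thesis by metis
  next
    case (Suc k)
    then have "out' i' = (if i' = k then 0 else out i')" using that out' by simp
    moreover have "out k = Suc j" using M2[OF j Suc] by simp
    moreover have "out i' = Suc j \<Longrightarrow> i' = k" using M1[OF that(1), of j] Suc by simp
    ultimately show ?thesis by (metis nat.distinct(1) nat.inject)
  qed
  have at_i: "out' i = Suc j" using out' by simp
  show ?valid
    unfolding priced_matching_def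
  proof (intro conjI allI impI)
    fix i' j' assume i': "i' < n" "out' i' = Suc j'"
    show "(i', j') \<in> E" "(own(j := Suc i)) j' = Suc i'"
    proof (atomize (full), cases "i' = i")
      case True
      then show "(i', j') \<in> E \<and> (own(j := Suc i)) j' = Suc i'" using i' at_i e by simp
    next
      case False
      then have "out i' = Suc j'" "j' \<noteq> j" using other i' by blast+
      then show "(i', j') \<in> E \<and> (own(j := Suc i)) j' = Suc i'" using M1 i' by simp
    qed
  next
    fix j' i' assume j': "j' < n" "(own(j := Suc i)) j' = Suc i'"
    show "i' < n" "out' i' = Suc j'"
    proof (atomize (full), cases "j' = j")
      case True
      then show "i' < n \<and> out' i' = Suc j'" using j' at_i i by simp
    next
      case False
      then have "i' < n" "out i' = Suc j'" using M2 j' by simp_all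
      moreover from this have "i' \<noteq> i" using i by auto
      ultimately show "i' < n \<and> out' i' = Suc j'" using other False by blast
    qed
  next
    fix j' assume "j' < n" "(own(j := Suc i)) j' = 0"
    then show "(pr(j := Suc (pr j))) j' = 0" using M3 by (simp split: if_splits)
  next
    fix i' j1 j2 assume i': "i' < n" "out' i' = Suc j1" "(i', j2) \<in> E"
    show "(pr(j := Suc (pr j))) j1 \<le> Suc ((pr(j := Suc (pr j))) j2)"
    proof (cases "i' = i")
      case True
      then have "j1 = j" "pr j \<le> pr j2" using at_i i' least[of i' j2] i by auto
      then show ?thesis by simp
    next
      case False
      then have "out i' = Suc j1" "j1 \<noteq> j" using other i' by blast+
      then show ?thesis using M4[of i' j1 j2] i' by auto
    qed
  qed
  show ?card
  proof (cases "own j")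
    case 0
    then have "{i. i < n \<and> out' i \<noteq> 0} = insert i {i. i < n \<and> out i \<noteq> 0}"
      using out' i(1) by auto
    then show ?thesis using 0 i(2) by simp
  next
    case (Suc k)
    let ?S = "{i. i < n \<and> out i \<noteq> 0}"
    have k: "k \<in> ?S" using M2[OF j Suc] by simp
    have "{i. i < n \<and> out' i \<noteq> 0} = insert i (?S - {k})"
      using out' i(1) Suc by auto
    then have "card {i. i < n \<and> out' i \<noteq> 0} = Suc (card (?S - {k}))"
      using i(2) by simp
    also have "\<dots> = card ?S" using k by (intro card_Suc_Diff1) auto
    finally show ?thesis using Suc by simp
  qed
qed

end


section \<open>Reasoning about deterministic programs\<close>

text \<open>A weakest precondition with a time bound. The state comes last, so that
  \<open>runs c T Q\<close> is a state predicate and can itself be a postcondition. Point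
  distributions suffice because the program flips no coins.\<close>

definition runs :: "com \<Rightarrow> nat \<Rightarrow> (state \<Rightarrow> bool) \<Rightarrow> state \<Rightarrow> bool" where
  "runs c T Q s \<longleftrightarrow> (\<exists>s' t. exec c s (return_pmf (s', t)) \<and> t \<le> T \<and> Q s')"

lemma runs_weaken:
  "runs c T Q s \<Longrightarrow> T \<le> T' \<Longrightarrow> (\<And>s'. Q s' \<Longrightarrow> Q' s') \<Longrightarrow> runs c T' Q' s"
  unfolding runs_def by (meson le_trans)

lemma runs_time_mono: "runs c T Q s \<Longrightarrow> T \<le> T' \<Longrightarrow> runs c T' Q s"
  by (rule runs_weaken)

lemma runs_SKIP: "Q s \<Longrightarrow> runs SKIP 1 Q s"
  unfolding runs_def using exec_Skip by blast

lemma runs_Assign: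
  "Q (store x (aval i s) (aval j s) (aval a s) s) \<Longrightarrow> runs (Assign x i j a) 1 Q s"
  unfolding runs_def using exec_Assign by blast

lemma runs_Seq:
  assumes "runs c1 T1 (runs c2 T2 Q) s"
  shows "runs (Seq c1 c2) (T1 + T2) Q s"
proof -
  obtain s1 t1 s2 t2 where 1: "exec c1 s (return_pmf (s1, t1))" "t1 \<le> T1"
    and 2: "exec c2 s1 (return_pmf (s2, t2))" "t2 \<le> T2" and Q: "Q s2"
    using assms unfolding runs_def by blast
  have "exec (Seq c1 c2) s (bind_pmf (return_pmf (s1, t1))
      (\<lambda>(s', t). map_pmf (\<lambda>(s'', t'). (s'', t + t')) (return_pmf (s2, t2))))"
    using 2 by (intro exec_Seq[OF 1(1)]) auto
  then have "exec (Seq c1 c2) s (return_pmf (s2, t1 + t2))"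
    by (simp add: bind_return_pmf)
  then show ?thesis unfolding runs_def using 1 2 Q by (meson add_mono)
qed

lemma runs_If:
  assumes "bval b s \<Longrightarrow> runs c1 T1 Q s" "\<not> bval b s \<Longrightarrow> runs c2 T2 Q s"
  shows "runs (If b c1 c2) (Suc (max T1 T2)) Q s"
proof -
  have "runs (if bval b s then c1 else c2) (max T1 T2) Q s"
    using assms runs_time_mono[of _ T1 Q s "max T1 T2"] runs_time_mono[of _ T2 Q s "max T1 T2"] by simp
  then obtain s' t where "exec (if bval b s then c1 else c2) s (return_pmf (s', t))"
    "t \<le> max T1 T2" "Q s'"
    unfolding runs_def by blast
  then show ?thesis
    unfolding runs_def using exec_If[of b s c1 c2 "return_pmf (s', t)"]
    by (auto intro!: exI[of _ s'] exI[of _ "Suc t"])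
qed

text \<open>Each iteration costs the body plus one unit for the test; the failing test and the final
  \<open>SKIP\<close> account for the remaining 2.\<close>

lemma runs_While_measure:
  assumes body: "\<And>s. I s \<Longrightarrow> bval b s \<Longrightarrow> runs c T (\<lambda>s'. I s' \<and> (\<mu> s' :: nat) < \<mu> s) s"
    and exit: "\<And>s. I s \<Longrightarrow> \<not> bval b s \<Longrightarrow> Q s"
  shows "I s \<Longrightarrow> runs (While b c) (\<mu> s * Suc T + 2) Q s"
proof (induction "\<mu> s" arbitrary: s rule: less_induct)
  case less
  have "runs (If b (Seq c (While b c)) SKIP) (\<mu> s * Suc T + 2) Q s"
  proof (cases "bval b s")
    case True
    have "runs c T (runs (While b c) ((\<mu> s - 1) * Suc T + 2) Q) s"
    proof (rule runs_weaken[OF body[OF less.prems True] order.refl])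
      fix s' assume s': "I s' \<and> \<mu> s' < \<mu> s"
      then have "\<mu> s' * Suc T \<le> (\<mu> s - 1) * Suc T" by (intro mult_le_mono1) linarith
      then have "\<mu> s' * Suc T + 2 \<le> (\<mu> s - 1) * Suc T + 2" by (rule add_le_mono1)
      moreover have "runs (While b c) (\<mu> s' * Suc T + 2) Q s'"
        using less.hyps[of s'] s' by blast
      ultimately show "runs (While b c) ((\<mu> s - 1) * Suc T + 2) Q s'"
        by (rule runs_time_mono[rotated])
    qed
    moreover have "\<mu> s > 0" using body[OF less.prems True] by (auto simp: runs_def)
    then have "Suc (T + ((\<mu> s - 1) * Suc T + 2)) = \<mu> s * Suc T + 2"
      by (cases "\<mu> s") auto
    ultimately show ?thesis
      using runs_If[of b s "Seq c (While b c)" "T + ((\<mu> s - 1) * Suc T + 2)" Q SKIP 0] True runs_Seq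
      by fastforce
  next
    case False
    then show ?thesis
      using runs_If[of b s "Seq c (While b c)" 1 Q SKIP 1] runs_SKIP[of Q s] exit[OF less.prems]
        runs_time_mono[of _ "Suc (Suc 0)" Q s "\<mu> s * Suc T + 2"] by simp
  qed
  then show ?case unfolding runs_def using exec_While by blast
qed

lemma runs_While:
  assumes "I s" "\<mu> s \<le> B"
    and "\<And>s. I s \<Longrightarrow> bval b s \<Longrightarrow> runs c T (\<lambda>s'. I s' \<and> (\<mu> s' :: nat) < \<mu> s) s"
    and "\<And>s. I s \<Longrightarrow> \<not> bval b s \<Longrightarrow> Q s"
  shows "runs (While b c) (B * Suc T + 2) Q s"
proof (rule runs_weaken)
  show "runs (While b c) (\<mu> s * Suc T + 2) Q s"
    using runs_While_measure[of I b c T \<mu> Q s] assms by blast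
  show "\<mu> s * Suc T + 2 \<le> B * Suc T + 2" using mult_le_mono1[OF assms(2)] by (rule add_le_mono1)
qed

lemma store_apply [simp]:
  "store x i j v s y i' j' = (if y = x \<and> i' = i \<and> j' = j then v else s y i' j')"
  by (simp add: store_def)



section \<open>The program\<close>

abbreviation Var :: "vname \<Rightarrow> aexp" where
  "Var x \<equiv> Cell x (N 0) (N 0)"

abbreviation Set :: "vname \<Rightarrow> aexp \<Rightarrow> com" where
  "Set x a \<equiv> Assign x (N 0) (N 0) a"

abbreviation Incr :: "vname \<Rightarrow> com" where
  "Incr x \<equiv> Set x (Plus (Var x) (N 1))"

abbreviation At :: "vname \<Rightarrow> aexp \<Rightarrow> aexp" where
  "At x i \<equiv> Cell x i (N 0)"

text \<open>The machine cannot multiply, but \<open>cap\<close> is a constant of the program, so a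
  repeated sum is an expression of fixed size.\<close>

fun times :: "nat \<Rightarrow> aexp \<Rightarrow> aexp" where
  "times 0 a = N 0"
| "times (Suc k) a = Plus a (times k a)"

lemma aval_times [simp]: "aval (times k a) s = k * aval a s"
  by (induction k) auto

subsection \<open>Picking\<close>

definition find_open :: "nat \<Rightarrow> com" where
  "find_open cap =
     While (Not (Less (At ''load'' (Cell ''pref'' (Var ''i'') (Var ''q''))) (N cap))) (Incr ''q'')"

definition pick_all :: "nat \<Rightarrow> com" where
  "pick_all cap =
     While (Less (Var ''t'') (times (cap - 2) (Var ''n'')))
       (Seq (Set ''i'' (Mod (Var ''t'') (Var ''n'')))
       (Seq (Set ''q'' (N 0))
       (Seq (find_open cap)
       (Seq (Set ''j'' (Cell ''pref'' (Var ''i'') (Var ''q'')))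
       (Seq (Assign ''load'' (Var ''j'') (N 0) (Plus (At ''load'' (Var ''j'')) (N 1)))
       (Seq (Assign ''edge'' (Var ''i'') (Var ''j'') (N 1))
            (Incr ''t'')))))))"

text \<open>The search has no bounds test: before pick \<open>cap * n\<close> some item is open, so
  it stops at position \<open>rank t < n\<close>.\<close>

lemma (in round_robin) runs_find_open:
  assumes t: "t < cap * n" and i: "s ''i'' 0 0 = t mod n" and q: "s ''q'' 0 0 = 0"
    and prefs: "\<And>q. q < n \<Longrightarrow> s ''pref'' (t mod n) q = P ! (t mod n) ! q"
    and load: "\<And>j. s ''load'' j 0 = used t j"
  shows "runs (find_open cap) (n * Suc 1 + 2) (\<lambda>s'. s' = store ''q'' 0 0 (rank t) s) s"
proof -
  define I where "I s' \<longleftrightarrow> (\<exists>q\<le>rank t. s' = store ''q'' 0 0 q s)" for s'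
  let ?b = "Not (Less (At ''load'' (Cell ''pref'' (Var ''i'') (Var ''q''))) (N cap))"
  have rank: "rank t < n" using rank_less[OF t] .
  have test: "bval ?b (store ''q'' 0 0 q s) \<longleftrightarrow> q \<noteq> rank t" if "q \<le> rank t" for q
  proof (cases "q = rank t")
    case True
    then show ?thesis using rank i prefs[of q] load used_taken[OF t] by (simp add: taken_def)
  next
    case False
    then show ?thesis
      using that rank i prefs[of q] load used_before_rank[OF t, of q] by (simp add: not_less)
  qed
  have "runs (While ?b (Incr ''q'')) (n * Suc 1 + 2) (\<lambda>s'. s' = store ''q'' 0 0 (rank t) s) s"
  proof (rule runs_While[where I = I and \<mu> = "\<lambda>s. rank t - s ''q'' 0 0"])
    have "s = store ''q'' 0 0 0 s" using q by (auto simp: fun_eq_iff)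
    then show "I s" unfolding I_def by blast
    show "rank t - s ''q'' 0 0 \<le> n" using rank by simp
  next
    fix s' assume "I s'" and b: "bval ?b s'"
    then obtain q where q: "q \<le> rank t" "s' = store ''q'' 0 0 q s" unfolding I_def by blast
    then have "q < rank t" using test b by auto
    moreover have "store ''q'' 0 0 (Suc q) (store ''q'' 0 0 q s) = store ''q'' 0 0 (Suc q) s"
      by (auto simp: fun_eq_iff)
    ultimately have "I (store ''q'' 0 0 (Suc q) s')" "q < rank t"
      unfolding I_def q(2) by (metis Suc_leI)+
    then show "runs (Incr ''q'') 1
        (\<lambda>s''. I s'' \<and> rank t - s'' ''q'' 0 0 < rank t - s' ''q'' 0 0) s'"
      using q(2) by (intro runs_Assign) simp
  next
    fix s' assume "I s'" "\<not> bval ?b s'"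
    then show "s' = store ''q'' 0 0 (rank t) s" using test unfolding I_def by blast
  qed
  then show ?thesis unfolding find_open_def .
qed

text \<open>The frame clause preserves the input for later rounds and also keeps the zeros that the
  auction expects in its own arrays.\<close>

definition (in round_robin) picks_state :: "state \<Rightarrow> nat \<Rightarrow> state \<Rightarrow> bool" where
  "picks_state s0 t s \<longleftrightarrow>
     s ''t'' 0 0 = t \<and> (\<forall>j. s ''load'' j 0 = used t j) \<and>
     (\<forall>i j. 0 < s ''edge'' i j \<longleftrightarrow> (i, j) \<in> picks t) \<and>
     (\<forall>x i j. x \<notin> {''t'', ''i'', ''q'', ''j'', ''load'', ''edge''} \<longrightarrow> s x i j = s0 x i j)"

lemma (in round_robin) runs_pick_all:
  fixes m :: nat
  defines "s0 \<equiv> input_state n m P"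
  shows "runs (pick_all cap) (cap * n * Suc (2 * n + 8) + 2) (picks_state s0 ((cap - 2) * n)) s0"
proof -
  define I where "I s \<longleftrightarrow> (\<exists>t\<le>(cap - 2) * n. picks_state s0 t s)" for s
  let ?L = "(cap - 2) * n"
  let ?b = "Less (Var ''t'') (times (cap - 2) (Var ''n''))"
  have n: "s ''n'' 0 0 = n" if "picks_state s0 t s" for t s
    using that by (simp add: picks_state_def s0_def input_state_def)
  have "runs (pick_all cap) (cap * n * Suc (2 * n + 8) + 2) (picks_state s0 ?L) s0"
    unfolding pick_all_def
  proof (rule runs_While[where I = I and \<mu> = "\<lambda>s. ?L - s ''t'' 0 0"])
    have "picks_state s0 0 s0"
      by (auto simp: picks_state_def s0_def input_state_def picks_def)
    then show "I s0" unfolding I_def by blast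
    show "?L - s0 ''t'' 0 0 \<le> cap * n"
      by (rule le_trans[OF diff_le_self]) simp
  next
    fix s assume "I s" and b: "bval ?b s"
    then obtain t where t: "t \<le> ?L" and s: "picks_state s0 t s" unfolding I_def by blast
    have tL: "t < ?L" using b s n[OF s] by (simp add: picks_state_def)
    also have "\<dots> \<le> cap * n" by simp
    finally have tn: "t < cap * n" .
    have modn: "t mod n < n" using tn by (cases n) auto
    have prefs: "s ''pref'' (t mod n) q = P ! (t mod n) ! q" if "q < n" for q
      using s modn that by (simp add: picks_state_def s0_def input_state_def)
    have load: "s ''load'' j 0 = used t j" for j using s by (simp add: picks_state_def)
    have st: "s ''t'' 0 0 = t" using s by (simp add: picks_state_def)
    let ?s1 = "store ''q'' 0 0 0 (store ''i'' 0 0 (t mod n) s)"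
    have find: "runs (find_open cap) (n * Suc 1 + 2) (\<lambda>s'. s' = store ''q'' 0 0 (rank t) ?s1) ?s1"
      by (rule runs_find_open[OF tn]) (simp_all add: prefs load)
    have rank: "rank t < n" using rank_less[OF tn] .
    have "picks_state s0 (Suc t) s'" if s': "s' =
        store ''t'' 0 0 (Suc t) (store ''edge'' (t mod n) (taken t) 1
          (store ''load'' (taken t) 0 (Suc (used t (taken t)))
            (store ''j'' 0 0 (taken t) (store ''q'' 0 0 (rank t) ?s1))))" for s'
      using s unfolding s' by (auto simp: picks_state_def used_Suc picks_Suc)
    then have post: "I s' \<and> ?L - s' ''t'' 0 0 < ?L - s ''t'' 0 0" if s': "s' =
        store ''t'' 0 0 (Suc t) (store ''edge'' (t mod n) (taken t) 1
          (store ''load'' (taken t) 0 (Suc (used t (taken t)))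
            (store ''j'' 0 0 (taken t) (store ''q'' 0 0 (rank t) ?s1))))" for s'
      using s' tL st unfolding I_def by (auto intro!: exI[of _ "Suc t"])
    show "runs (Seq (Set ''i'' (Mod (Var ''t'') (Var ''n'')))
       (Seq (Set ''q'' (N 0))
       (Seq (find_open cap)
       (Seq (Set ''j'' (Cell ''pref'' (Var ''i'') (Var ''q'')))
       (Seq (Assign ''load'' (Var ''j'') (N 0) (Plus (At ''load'' (Var ''j'')) (N 1)))
       (Seq (Assign ''edge'' (Var ''i'') (Var ''j'') (N 1))
            (Incr ''t'')))))))
       (2 * n + 8) (\<lambda>s'. I s' \<and> ?L - s' ''t'' 0 0 < ?L - s ''t'' 0 0) s"
      \<comment> \<open>The bound \<open>2 * n + 8\<close> is the search, \<open>2 * n + 2\<close>,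
        plus six assignments.\<close>
      apply (rule runs_weaken)
        apply (rule runs_Seq, rule runs_Assign)
        apply (rule runs_Seq, rule runs_Assign)
        apply (rule runs_Seq)
        apply (rule runs_weaken)
          apply (use find in \<open>simp add: st n[OF s]\<close>)
         apply (rule order.refl)
        apply (rule runs_Seq, rule runs_Assign)+
        apply (rule runs_Assign)
        apply (rule post)
        apply (simp add: prefs rank st load flip: taken_def)
       apply simp
      apply assumption
      done
  next
    fix s assume "I s" "\<not> bval ?b s"
    then show "picks_state s0 ?L s" using n by (auto simp: I_def picks_state_def)
  qed
  then show ?thesis .
qed

subsection \<open>The auction\<close>

text \<open>The value \<open>n\<close> is no item: in \<open>bj\<close> it means that no bid has
  been found, and the price stored there is the bar that the first bid must undercut.\<close>

definition find_bid :: com where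
  "find_bid =
     Seq (Set ''bj'' (Var ''n''))
    (Seq (Set ''i'' (N 0))
         (While (Less (Var ''i'') (Var ''n''))
           (Seq (Set ''j'' (N 0))
           (Seq (While (Less (Var ''j'') (Var ''n''))
                  (Seq (If (And (Less (At ''out'' (Var ''i'')) (N 1))
                             (And (Less (N 0) (Cell ''edge'' (Var ''i'') (Var ''j'')))
                               (Less (At ''price'' (Var ''j'')) (At ''price'' (Var ''bj'')))))
                          (Seq (Set ''bi'' (Var ''i'')) (Set ''bj'' (Var ''j'')))
                          SKIP)
                       (Incr ''j'')))
                (Incr ''i'')))))"

definition place_bid :: com where
  "place_bid =
     Seq (If (Less (N 0) (At ''own'' (Var ''bj'')))
            (Assign ''out'' (Minus (At ''own'' (Var ''bj'')) (N 1)) (N 0) (N 0))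
            (Incr ''cnt''))
    (Seq (Assign ''out'' (Var ''bi'') (N 0) (Plus (Var ''bj'') (N 1)))
    (Seq (Assign ''own'' (Var ''bj'') (N 0) (Plus (Var ''bi'') (N 1)))
         (Assign ''price'' (Var ''bj'') (N 0) (Plus (At ''price'' (Var ''bj'')) (N 1)))))"

text \<open>The extra cell \<open>n\<close> of the price array is a sentinel above all prices at which the auction
  can still be running.\<close>

definition run_auction :: com where
  "run_auction =
     Seq (Assign ''price'' (Var ''n'') (N 0) (Plus (Var ''n'') (N 1)))
         (While (Less (Var ''cnt'') (Var ''m'')) (Seq find_bid place_bid))"

text \<open>Invariant of the scan, with \<open>s\<close> the state before it and \<open>s'\<close>
  the current one: the pairs lexicographically before \<open>(i, j)\<close> have been
  inspected.\<close>

definition best_bid :: "nat \<Rightarrow> state \<Rightarrow> nat \<Rightarrow> nat \<Rightarrow> state \<Rightarrow> bool" where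
  "best_bid n s i j s' \<longleftrightarrow>
     (\<forall>x a b. x \<notin> {''i'', ''j'', ''bi'', ''bj''} \<longrightarrow> s' x a b = s x a b) \<and>
     (s' ''bj'' 0 0 = n \<or>
        s' ''bj'' 0 0 < n \<and> s' ''bi'' 0 0 < n \<and>
        s ''out'' (s' ''bi'' 0 0) 0 = 0 \<and> 0 < s ''edge'' (s' ''bi'' 0 0) (s' ''bj'' 0 0) \<and>
        s ''price'' (s' ''bj'' 0 0) 0 < s ''price'' n 0) \<and>
     (\<forall>i' j'. j' < n \<longrightarrow> i' < i \<or> i' = i \<and> j' < j \<longrightarrow>
        s ''out'' i' 0 = 0 \<longrightarrow> 0 < s ''edge'' i' j' \<longrightarrow>
        s ''price'' (s' ''bj'' 0 0) 0 \<le> s ''price'' j' 0)"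

lemma
  assumes "best_bid n s i j s'"
  shows best_bid_frame: "x \<notin> {''i'', ''j'', ''bi'', ''bj''} \<Longrightarrow> s' x a b = s x a b"
    and best_bid_pair: "s' ''bj'' 0 0 = n \<or>
      s' ''bj'' 0 0 < n \<and> s' ''bi'' 0 0 < n \<and>
      s ''out'' (s' ''bi'' 0 0) 0 = 0 \<and> 0 < s ''edge'' (s' ''bi'' 0 0) (s' ''bj'' 0 0) \<and>
      s ''price'' (s' ''bj'' 0 0) 0 < s ''price'' n 0"
    and best_bid_least: "\<lbrakk>j' < n; i' < i \<or> i' = i \<and> j' < j; s ''out'' i' 0 = 0; 0 < s ''edge'' i' j'\<rbrakk>
      \<Longrightarrow> s ''price'' (s' ''bj'' 0 0) 0 \<le> s ''price'' j' 0"
proof -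
  note conj = assms[unfolded best_bid_def]
  show "x \<notin> {''i'', ''j'', ''bi'', ''bj''} \<Longrightarrow> s' x a b = s x a b"
    using conj[THEN conjunct1, rule_format] .
  show "s' ''bj'' 0 0 = n \<or>
      s' ''bj'' 0 0 < n \<and> s' ''bi'' 0 0 < n \<and>
      s ''out'' (s' ''bi'' 0 0) 0 = 0 \<and> 0 < s ''edge'' (s' ''bi'' 0 0) (s' ''bj'' 0 0) \<and>
      s ''price'' (s' ''bj'' 0 0) 0 < s ''price'' n 0"
    using conj[THEN conjunct2, THEN conjunct1] .
  show "\<lbrakk>j' < n; i' < i \<or> i' = i \<and> j' < j; s ''out'' i' 0 = 0; 0 < s ''edge'' i' j'\<rbrakk>
      \<Longrightarrow> s ''price'' (s' ''bj'' 0 0) 0 \<le> s ''price'' j' 0"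
    using conj[THEN conjunct2, THEN conjunct2, rule_format] .
qed

lemma best_bid_skip:
  assumes best: "best_bid n s i j s'"
    and skip: "\<not> (s ''out'' i 0 = 0 \<and> 0 < s ''edge'' i j \<and>
      s ''price'' j 0 < s ''price'' (s' ''bj'' 0 0) 0)"
  shows "best_bid n s i (Suc j) (store ''j'' 0 0 (Suc j) s')"
proof -
  let ?s = "store ''j'' 0 0 (Suc j) s'"
  have least: "s ''price'' (s' ''bj'' 0 0) 0 \<le> s ''price'' j' 0"
    if "j' < n" "i' < i \<or> i' = i \<and> j' < Suc j" "s ''out'' i' 0 = 0" "0 < s ''edge'' i' j'" for i' j'
  proof (cases "i' = i \<and> j' = j")
    case True
    then show ?thesis using skip that(3,4) by simp
  next
    case False
    then have "i' < i \<or> i' = i \<and> j' < j" using that(2) by auto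
    then show ?thesis using best_bid_least[OF best that(1)] that(3,4) by blast
  qed
  show ?thesis
    unfolding best_bid_def
  proof (intro conjI allI impI)
    show "?s x a b = s x a b" if "x \<notin> {''i'', ''j'', ''bi'', ''bj''}" for x a b
      using that best_bid_frame[OF best] by simp
  qed (use best_bid_pair[OF best] least in simp_all)
qed

lemma best_bid_update:
  assumes best: "best_bid n s i j s'" and ij: "i < n" "j < n"
    and better: "s ''out'' i 0 = 0" "0 < s ''edge'' i j"
      "s ''price'' j 0 < s ''price'' (s' ''bj'' 0 0) 0"
  shows "best_bid n s i (Suc j)
    (store ''j'' 0 0 (Suc j) (store ''bj'' 0 0 j (store ''bi'' 0 0 i s')))" (is "best_bid _ _ _ _ ?s")
proof -
  have least: "s ''price'' j 0 \<le> s ''price'' j' 0"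
    if "j' < n" "i' < i \<or> i' = i \<and> j' < Suc j" "s ''out'' i' 0 = 0" "0 < s ''edge'' i' j'" for i' j'
  proof (cases "i' = i \<and> j' = j")
    case False
    then have "i' < i \<or> i' = i \<and> j' < j" using that(2) by auto
    then have "s ''price'' (s' ''bj'' 0 0) 0 \<le> s ''price'' j' 0"
      using best_bid_least[OF best that(1)] that(3,4) by blast
    then show ?thesis using better(3) by simp
  qed simp
  have below: "s ''price'' j 0 < s ''price'' n 0"
    using best_bid_pair[OF best] better(3) by auto
  show ?thesis
    unfolding best_bid_def
  proof (intro conjI allI impI)
    show "?s x a b = s x a b" if "x \<notin> {''i'', ''j'', ''bi'', ''bj''}" for x a b
      using that best_bid_frame[OF best] by simp
  qed (use ij better least below in simp_all)
qed

lemma runs_find_bid: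
  assumes n: "s ''n'' 0 0 = n"
  shows "runs find_bid (n * Suc (5 * n + 4) + 4) (best_bid n s n 0) s"
proof -
  define J where "J i s' \<longleftrightarrow>
    i < n \<and> s' ''i'' 0 0 = i \<and> s' ''j'' 0 0 \<le> n \<and> best_bid n s i (s' ''j'' 0 0) s'" for i s'
  define I where "I s' \<longleftrightarrow> s' ''i'' 0 0 \<le> n \<and> best_bid n s (s' ''i'' 0 0) 0 s'" for s'
  have n': "s' ''n'' 0 0 = n" if "best_bid n s i j s'" for i j s'
    using that n by (simp add: best_bid_def)
  have nJ: "s' ''n'' 0 0 = n" if "J i s'" for i s' using that n' unfolding J_def by blast
  have nI: "s' ''n'' 0 0 = n" if "I s'" for s' using that n' unfolding I_def by blast
  let ?test = "And (Less (At ''out'' (Var ''i'')) (N 1))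
                             (And (Less (N 0) (Cell ''edge'' (Var ''i'') (Var ''j'')))
                               (Less (At ''price'' (Var ''j'')) (At ''price'' (Var ''bj''))))"
  let ?inner = "While (Less (Var ''j'') (Var ''n''))
                  (Seq (If ?test (Seq (Set ''bi'' (Var ''i'')) (Set ''bj'' (Var ''j''))) SKIP)
                       (Incr ''j''))"
  have inner: "runs ?inner (n * Suc 4 + 2)
      (\<lambda>s''. best_bid n s i n s'' \<and> s'' ''i'' 0 0 = i) s'" if "J i s'" for i s'
  proof (rule runs_While[where I = "J i" and \<mu> = "\<lambda>s. n - s ''j'' 0 0"])
    fix s' assume J: "J i s'" and "bval (Less (Var ''j'') (Var ''n'')) s'"
    then have j: "s' ''j'' 0 0 < n" using nJ[OF J] by simp
    define j where "j = s' ''j'' 0 0"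
    have i: "i < n" "s' ''i'' 0 0 = i" and best: "best_bid n s i j s'"
      using J by (auto simp: J_def j_def)
    have same: "s' ''out'' a b = s ''out'' a b" "s' ''edge'' a b = s ''edge'' a b"
      "s' ''price'' a b = s ''price'' a b" for a b
      using best by (auto simp: best_bid_def)
    have post: "J i s'' \<and> n - s'' ''j'' 0 0 < n - s' ''j'' 0 0"
      if "best_bid n s i (Suc j) s''" "s'' ''j'' 0 0 = Suc j" "s'' ''i'' 0 0 = i" for s''
      using that i j by (simp add: J_def j_def)
    show "runs (Seq (If ?test (Seq (Set ''bi'' (Var ''i'')) (Set ''bj'' (Var ''j''))) SKIP)
        (Incr ''j'')) 4 (\<lambda>s''. J i s'' \<and> n - s'' ''j'' 0 0 < n - s' ''j'' 0 0) s'"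
      apply (rule runs_time_mono)
       apply (rule runs_Seq, rule runs_If)
         apply (rule runs_Seq, rule runs_Assign, rule runs_Assign, rule runs_Assign)
         apply (rule post)
           apply (use best_bid_update[OF best i(1)] i(2) j same in \<open>simp_all add: j_def\<close>)[3]
        apply (rule runs_SKIP, rule runs_Assign)
        apply (rule post)
          apply (use best_bid_skip[OF best] i(2) same in \<open>simp_all add: j_def\<close>)
      done
  next
    show "J i s'" by fact
    fix s' assume J: "J i s'" and "\<not> bval (Less (Var ''j'') (Var ''n'')) s'"
    then have "s' ''j'' 0 0 = n" using nJ[OF J] by (simp add: J_def)
    then show "best_bid n s i n s' \<and> s' ''i'' 0 0 = i" using J by (simp add: J_def)
  qed simp
  let ?outer = "While (Less (Var ''i'') (Var ''n''))
    (Seq (Set ''j'' (N 0)) (Seq ?inner (Incr ''i'')))"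
  have outer: "runs ?outer (n * Suc (5 * n + 4) + 2) (best_bid n s n 0) s'" if "I s'" for s'
  proof (rule runs_While[where I = I and \<mu> = "\<lambda>s. n - s ''i'' 0 0"])
    fix s' assume I: "I s'" and "bval (Less (Var ''i'') (Var ''n'')) s'"
    then have i: "s' ''i'' 0 0 < n" using nI[OF I] by simp
    define i where "i = s' ''i'' 0 0"
    have J: "J i (store ''j'' 0 0 0 s')"
      using I i by (auto simp: J_def I_def i_def best_bid_def)
    \<comment> \<open>The bounds \<open>(i, n)\<close> and \<open>(i + 1, 0)\<close> describe the
      same inspected pairs, as all item indices are below \<open>n\<close>.\<close>
    have post: "I s3 \<and> n - s3 ''i'' 0 0 < n - s' ''i'' 0 0"
      if "best_bid n s i n s2" "s2 ''i'' 0 0 = i" "s3 = store ''i'' 0 0 (Suc i) s2" for s2 s3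
      using that i by (auto simp: I_def i_def best_bid_def less_Suc_eq)
    let ?Q = "\<lambda>s''. I s'' \<and> n - s'' ''i'' 0 0 < n - s' ''i'' 0 0"
    have "runs (Incr ''i'') 1 ?Q s2" if "best_bid n s i n s2 \<and> s2 ''i'' 0 0 = i" for s2
      by (rule runs_Assign, rule post) (use that in simp_all)
    then have "runs (Seq ?inner (Incr ''i'')) (n * Suc 4 + 2 + 1) ?Q (store ''j'' 0 0 0 s')"
      by (intro runs_Seq runs_weaken[OF inner[OF J] order.refl])
    then have "runs (Seq (Set ''j'' (N 0)) (Seq ?inner (Incr ''i'')))
        (1 + (n * Suc 4 + 2 + 1)) ?Q s'"
      by (intro runs_Seq[OF runs_Assign]) (simp only: aval.simps)
    then show "runs (Seq (Set ''j'' (N 0)) (Seq ?inner (Incr ''i''))) (5 * n + 4) ?Q s'"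
      by (rule runs_time_mono) simp
  next
    show "I s'" by fact
    fix s' assume I: "I s'" and "\<not> bval (Less (Var ''i'') (Var ''n'')) s'"
    then have "s' ''i'' 0 0 = n" using nI[OF I] by (simp add: I_def)
    then show "best_bid n s n 0 s'" using I by (simp add: I_def)
  qed simp
  let ?s1 = "store ''bj'' 0 0 n s"
  have "I (store ''i'' 0 0 0 ?s1)"
    unfolding I_def best_bid_def by simp
  from outer[OF this] have
    "runs (Seq (Set ''i'' (N 0)) ?outer) (1 + (n * Suc (5 * n + 4) + 2)) (best_bid n s n 0) ?s1"
    by (intro runs_Seq[OF runs_Assign]) (simp only: aval.simps)
  then have "runs find_bid (1 + (1 + (n * Suc (5 * n + 4) + 2))) (best_bid n s n 0) s"
    unfolding find_bid_def by - (rule runs_Seq[OF runs_Assign], simp only: aval.simps n)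
  then show ?thesis by (rule runs_time_mono) simp
qed


section \<open>Progress, termination and output of the auction program\<close>

context auction
begin

text \<open>The cap \<open>Suc n\<close> on prices makes the number of bids finite, and
  \<open>cnt \<le> m\<close> turns the failing loop test into equality.\<close>

definition auction_state :: "nat \<Rightarrow> state \<Rightarrow> bool" where
  "auction_state m s \<longleftrightarrow>
     priced_matching (\<lambda>i. s ''out'' i 0) (\<lambda>j. s ''own'' j 0) (\<lambda>j. s ''price'' j 0) \<and>
     s ''cnt'' 0 0 = card {i. i < n \<and> s ''out'' i 0 \<noteq> 0} \<and> s ''cnt'' 0 0 \<le> m \<and>
     (\<forall>i j. 0 < s ''edge'' i j \<longleftrightarrow> (i, j) \<in> E) \<and>
     (\<forall>j<n. s ''price'' j 0 \<le> Suc n) \<and> s ''price'' n 0 = Suc n \<and>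
     s ''n'' 0 0 = n \<and> s ''m'' 0 0 = m"

text \<open>If the scan left \<open>bj\<close> at the sentinel, every item reachable by a free agent
  would cost more than \<open>n\<close>. Then few agents are free, against \<open>many\<close> for
  the current \<open>cnt\<close>.\<close>

lemma best_bid_found:
  assumes s: "auction_state m s" and less: "s ''cnt'' 0 0 < m"
    and many: "\<And>k. k < m \<Longrightarrow> (cap - R) * n < cap * (n - k)"
    and best: "best_bid n s n 0 s'"
  shows "s' ''bj'' 0 0 < n"
proof (rule ccontr)
  assume "\<not> ?thesis"
  then have bj: "s' ''bj'' 0 0 = n" using best_bid_pair[OF best] by simp
  let ?F = "{i. i < n \<and> s ''out'' i 0 = 0}" and ?M = "{i. i < n \<and> s ''out'' i 0 \<noteq> 0}"
  have "cap * card ?F \<le> (cap - R) * n"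
  proof (rule free_agents_card_le)
    show "priced_matching (\<lambda>i. s ''out'' i 0) (\<lambda>j. s ''own'' j 0) (\<lambda>j. s ''price'' j 0)"
      using s by (simp add: auction_state_def)
    fix i j assume ij: "i < n" "s ''out'' i 0 = 0" "(i, j) \<in> E"
    then have "j < n" "0 < s ''edge'' i j" using s edges by (auto simp: auction_state_def)
    then have "s ''price'' n 0 \<le> s ''price'' j 0"
      using best_bid_least[OF best, of j i] ij bj by simp
    then show "n < s ''price'' j 0" using s by (simp add: auction_state_def)
  qed
  have "card ?F + card ?M = card (?F \<union> ?M)"
    by (subst card_Un_disjoint) auto
  moreover have "?F \<union> ?M = {..<n}" by auto
  ultimately have "card ?F = n - card ?M" by simp
  with \<open>cap * card ?F \<le> (cap - R) * n\<close> have "cap * (n - card ?M) \<le> (cap - R) * n" by simp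
  then show False using many[OF less] s by (simp add: auction_state_def)
qed

text \<open>The chosen item undercuts the sentinel, so its price is at most \<open>n\<close> and may
  rise by one. The summed distance of the prices from \<open>n + 1\<close> thus drops with each bid,
  which allows at most \<open>n * (n + 1)\<close> bids.\<close>

lemma auction_state_bid:
  assumes s: "auction_state m s" and less: "s ''cnt'' 0 0 < m"
    and best: "best_bid n s n 0 s'" and bj: "s' ''bj'' 0 0 < n"
  defines "i \<equiv> s' ''bi'' 0 0" and "j \<equiv> s' ''bj'' 0 0"
  assumes s1: "s1 = (if 0 < s ''own'' j 0 then store ''out'' (s ''own'' j 0 - 1) 0 0 s'
    else store ''cnt'' 0 0 (Suc (s ''cnt'' 0 0)) s')"
  assumes s2: "s2 = store ''price'' j 0 (Suc (s ''price'' j 0))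
    (store ''own'' j 0 (Suc i) (store ''out'' i 0 (Suc j) s1))"
  shows "auction_state m s2 \<and>
    (\<Sum>j<n. Suc n - s2 ''price'' j 0) < (\<Sum>j<n. Suc n - s ''price'' j 0)"
proof -
  have frame: "s' x a b = s x a b" if "x \<notin> {''i'', ''j'', ''bi'', ''bj''}" for x a b
    using best_bid_frame[OF best that] .
  have j: "j < n" using bj by (simp add: j_def)
  then have i: "i < n" "s ''out'' i 0 = 0" "0 < s ''edge'' i j"
    using best_bid_pair[OF best] by (auto simp: i_def j_def)
  have M: "priced_matching (\<lambda>i. s ''out'' i 0) (\<lambda>j. s ''own'' j 0) (\<lambda>j. s ''price'' j 0)"
    and cnt: "s ''cnt'' 0 0 = card {i. i < n \<and> s ''out'' i 0 \<noteq> 0}"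
    and E: "\<And>i j. 0 < s ''edge'' i j \<longleftrightarrow> (i, j) \<in> E"
    and price: "\<And>j. j < n \<Longrightarrow> s ''price'' j 0 \<le> Suc n" "s ''price'' n 0 = Suc n"
    and nm: "s ''n'' 0 0 = n" "s ''m'' 0 0 = m"
    using s by (auto simp: auction_state_def)
  have least: "s ''price'' j 0 \<le> s ''price'' j' 0"
    if "i' < n" "s ''out'' i' 0 = 0" "(i', j') \<in> E" for i' j'
    using best_bid_least[OF best, of j' i'] that E edges by (auto simp: j_def)
  have low: "s ''price'' j 0 \<le> n"
    using best_bid_pair[OF best] bj price(2) by (simp add: j_def)
  have out: "(\<lambda>i. s2 ''out'' i 0) =
      (if s ''own'' j 0 = 0 then (\<lambda>i. s ''out'' i 0)
       else (\<lambda>i. s ''out'' i 0)(s ''own'' j 0 - 1 := 0))(i := Suc j)"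
    by (auto simp: s2 s1 frame fun_eq_iff)
  have own: "(\<lambda>j. s2 ''own'' j 0) = (\<lambda>j. s ''own'' j 0)(j := Suc i)"
    by (auto simp: s2 s1 frame fun_eq_iff)
  have pr: "(\<lambda>j. s2 ''price'' j 0) = (\<lambda>j. s ''price'' j 0)(j := Suc (s ''price'' j 0))"
    by (auto simp: s2 s1 frame fun_eq_iff)
  have ij: "(i, j) \<in> E" using E i(3) by simp
  have valid: "priced_matching (\<lambda>i. s2 ''out'' i 0) (\<lambda>j. s2 ''own'' j 0) (\<lambda>j. s2 ''price'' j 0)"
    unfolding own pr by (rule bid(1)[OF M i(1,2) ij _ out], erule (2) least)
  have "card {i. i < n \<and> s2 ''out'' i 0 \<noteq> 0} =
      card {i. i < n \<and> s ''out'' i 0 \<noteq> 0} + of_bool (s ''own'' j 0 = 0)"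
    by (rule bid(2)[OF M i(1,2) ij _ out], erule (2) least)
  moreover have "s2 ''cnt'' 0 0 = s ''cnt'' 0 0 + of_bool (s ''own'' j 0 = 0)"
    by (simp add: s2 s1 frame)
  ultimately have cnt': "s2 ''cnt'' 0 0 = card {i. i < n \<and> s2 ''out'' i 0 \<noteq> 0}" "s2 ''cnt'' 0 0 \<le> m"
    using less by (simp_all only: cnt) simp
  have pr': "s2 ''price'' a 0 = (if a = j then Suc (s ''price'' j 0) else s ''price'' a 0)" for a
    using fun_cong[OF pr, of a] by simp
  have rest: "s2 ''edge'' a b = s ''edge'' a b" "s2 ''n'' 0 0 = s ''n'' 0 0" "s2 ''m'' 0 0 = s ''m'' 0 0"
    for a b by (simp_all add: s2 s1 frame)
  have "auction_state m s2"
    unfolding auction_state_def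
  proof (intro conjI allI impI)
    show "s2 ''price'' a 0 \<le> Suc n" if "a < n" for a
      using price(1)[OF that] low by (simp add: pr')
    show "s2 ''price'' n 0 = Suc n" using price(2) j by (simp add: pr')
    show "0 < s2 ''edge'' a b \<longleftrightarrow> (a, b) \<in> E" for a b using E by (simp add: rest)
  qed (use nm rest valid cnt' in simp_all)
  moreover have "(\<Sum>a<n. Suc n - s2 ''price'' a 0) < (\<Sum>a<n. Suc n - s ''price'' a 0)"
    using j low by (intro sum_strict_mono_ex1) (auto simp: pr' intro!: bexI[of _ j])
  ultimately show ?thesis ..
qed

lemma runs_place_bid:
  assumes s: "auction_state m s" and less: "s ''cnt'' 0 0 < m"
    and best: "best_bid n s n 0 s'" and bj: "s' ''bj'' 0 0 < n"
  shows "runs place_bid 5 (\<lambda>s2. auction_state m s2 \<and>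
    (\<Sum>j<n. Suc n - s2 ''price'' j 0) < (\<Sum>j<n. Suc n - s ''price'' j 0)) s'"
proof -
  let ?i = "s' ''bi'' 0 0" and ?j = "s' ''bj'' 0 0"
  define s1 where "s1 = (if 0 < s ''own'' ?j 0 then store ''out'' (s ''own'' ?j 0 - 1) 0 0 s'
    else store ''cnt'' 0 0 (Suc (s ''cnt'' 0 0)) s')"
  have frame: "s' x a b = s x a b" if "x \<notin> {''i'', ''j'', ''bi'', ''bj''}" for x a b
    using best_bid_frame[OF best that] .
  let ?Q = "\<lambda>s2. auction_state m s2 \<and>
    (\<Sum>j<n. Suc n - s2 ''price'' j 0) < (\<Sum>j<n. Suc n - s ''price'' j 0)"
  note post = auction_state_bid[OF s less best bj s1_def refl]
  have s1: "s1 ''bi'' 0 0 = ?i" "s1 ''bj'' 0 0 = ?j" "s1 ''price'' a b = s ''price'' a b" for a b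
    by (simp_all add: s1_def frame)
  have "runs (Seq (Assign ''out'' (Var ''bi'') (N 0) (Plus (Var ''bj'') (N 1)))
    (Seq (Assign ''own'' (Var ''bj'') (N 0) (Plus (Var ''bi'') (N 1)))
         (Assign ''price'' (Var ''bj'') (N 0) (Plus (At ''price'' (Var ''bj'')) (N 1)))))
     (1 + (1 + 1)) ?Q s1"
    by (rule runs_Seq, rule runs_Assign, rule runs_Seq, rule runs_Assign, rule runs_Assign)
      (use post in \<open>simp add: s1 del: sum.lessThan_Suc\<close>)
  then have "runs place_bid (Suc (max 1 1) + (1 + (1 + 1))) ?Q s'"
    unfolding place_bid_def
    by - (rule runs_Seq, rule runs_If; rule runs_Assign, simp add: frame s1_def)
  then show ?thesis by (rule runs_time_mono) simp
qed

lemma runs_run_auction: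
  assumes many: "\<And>k. k < m \<Longrightarrow> (cap - R) * n < cap * (n - k)"
    and s: "s ''n'' 0 0 = n" "s ''m'' 0 0 = m" "\<And>i j. 0 < s ''edge'' i j \<longleftrightarrow> (i, j) \<in> E"
      "s ''cnt'' 0 0 = 0" "\<And>i. s ''out'' i 0 = 0" "\<And>j. s ''own'' j 0 = 0" "\<And>j. s ''price'' j 0 = 0"
  shows "runs run_auction (n * Suc n * Suc (n * Suc (5 * n + 4) + 9) + 3)
    (\<lambda>s'. auction_state m s' \<and> s' ''cnt'' 0 0 = m) s"
proof -
  let ?s = "store ''price'' n 0 (Suc n) s"
  have "runs (While (Less (Var ''cnt'') (Var ''m'')) (Seq find_bid place_bid))
    (n * Suc n * Suc (n * Suc (5 * n + 4) + 4 + 5) + 2)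
    (\<lambda>s'. auction_state m s' \<and> s' ''cnt'' 0 0 = m) ?s"
  proof (rule runs_While[where I = "auction_state m" and \<mu> = "\<lambda>s. \<Sum>j<n. Suc n - s ''price'' j 0"])
    show "auction_state m ?s"
      using s by (simp add: auction_state_def priced_matching_def)
    have "(\<Sum>j<n. Suc n - ?s ''price'' j 0) \<le> (\<Sum>j<n. Suc n)"
      by (intro sum_mono) simp
    then show "(\<Sum>j<n. Suc n - ?s ''price'' j 0) \<le> n * Suc n" by simp
  next
    fix s assume inv: "auction_state m s" and "bval (Less (Var ''cnt'') (Var ''m'')) s"
    then have less: "s ''cnt'' 0 0 < m" by (simp add: auction_state_def)
    have n: "s ''n'' 0 0 = n" using inv by (simp add: auction_state_def)
    show "runs (Seq find_bid place_bid) (n * Suc (5 * n + 4) + 4 + 5)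
       (\<lambda>s'. auction_state m s' \<and>
          (\<Sum>j<n. Suc n - s' ''price'' j 0) < (\<Sum>j<n. Suc n - s ''price'' j 0)) s"
      by (rule runs_Seq, rule runs_weaken[OF runs_find_bid[of s n, OF n] order.refl])
        (rule runs_place_bid[OF inv less _ best_bid_found[OF inv less many]])
  next
    fix s assume "auction_state m s" "\<not> bval (Less (Var ''cnt'') (Var ''m'')) s"
    then show "auction_state m s \<and> s ''cnt'' 0 0 = m" by (simp add: auction_state_def)
  qed
  then have "runs run_auction (1 + (n * Suc n * Suc (n * Suc (5 * n + 4) + 4 + 5) + 2))
    (\<lambda>s'. auction_state m s' \<and> s' ''cnt'' 0 0 = m) s"
    unfolding run_auction_def by - (rule runs_Seq[OF runs_Assign], simp only: aval.simps s(1) Suc_eq_plus1)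
  then show ?thesis by (rule runs_time_mono) simp
qed

lemma auction_state_output:
  assumes "auction_state m s"
  shows "output_matching n s \<subseteq> E" "is_matching n (output_matching n s)"
    and "card (output_matching n s) = s ''cnt'' 0 0"
proof -
  let ?M = "output_matching n s"
  have M: "priced_matching (\<lambda>i. s ''out'' i 0) (\<lambda>j. s ''own'' j 0) (\<lambda>j. s ''price'' j 0)"
    and cnt: "s ''cnt'' 0 0 = card {i. i < n \<and> s ''out'' i 0 \<noteq> 0}"
    using assms by (auto simp: auction_state_def)
  have own: "(i, j) \<in> E \<and> s ''own'' j 0 = Suc i" if "(i, j) \<in> ?M" for i j
    using priced_matchingD(1)[OF M, of i j] that by (simp add: output_matching_def)
  then show sub: "?M \<subseteq> E" by auto
  have fst: "inj_on fst ?M" by (auto simp: inj_on_def output_matching_def)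
  moreover have "inj_on snd ?M"
  proof (rule inj_onI)
    fix e e' assume e: "e \<in> ?M" "e' \<in> ?M" "snd e = snd e'"
    obtain i i' j where "e = (i, j)" "e' = (i', j)" using e(3) by (metis prod.collapse)
    then show "e = e'" using own[of i j] own[of i' j] e by simp
  qed
  ultimately show "is_matching n ?M" using sub edges by (auto simp: is_matching_def)
  have "fst ` ?M = {i. i < n \<and> (\<exists>j. s ''out'' i 0 = Suc j)}"
    by (force simp: output_matching_def)
  also have "\<dots> = {i. i < n \<and> s ''out'' i 0 \<noteq> 0}" by (simp add: gr0_conv_Suc)
  finally show "card ?M = s ''cnt'' 0 0" using card_image[OF fst] cnt by simp
qed

end

section \<open>The whole mechanism: size, running time and distortion\<close>

lemma less_nat_ceiling_iff: "k < nat \<lceil>x\<rceil> \<longleftrightarrow> real k < x"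
  by (simp add: zless_nat_eq_int_zless less_ceiling_iff)

text \<open>With \<open>R = cap - 2\<close> the deficiency \<open>cap - R\<close> is 2, so
  \<open>many\<close> says that more than \<open>2 n / cap\<close> agents are free as long as fewer
  than \<open>m\<close> are matched.\<close>

lemma (in round_robin) runs_mechanism:
  assumes many: "\<And>k. k < m \<Longrightarrow> 2 * n < cap * (n - k)" and cap: "cap \<ge> 2"
  shows "runs (Seq (pick_all cap) run_auction)
    (cap * n * Suc (2 * n + 8) + 2 + (n * Suc n * Suc (n * Suc (5 * n + 4) + 9) + 3))
    (\<lambda>s. output_matching n s \<subseteq> picks ((cap - 2) * n) \<and>
      is_matching n (output_matching n s) \<and> card (output_matching n s) = m)
    (input_state n m P)"
proof -
  let ?E = "picks ((cap - 2) * n)"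
  interpret auction n cap "cap - 2" ?E
  proof
    show "?E \<subseteq> {..<n} \<times> {..<n}" by (rule picks_subset) simp
    show "(cap - 2) * card A \<le> cap * card B"
      if "A \<subseteq> {..<n}" "finite B" "\<And>i j. (i, j) \<in> ?E \<Longrightarrow> i \<in> A \<Longrightarrow> j \<in> B" for A B
      using picks_neighbours_card[OF that(1,2) _ that(3)] by simp
  qed simp
  have many': "(cap - (cap - 2)) * n < cap * (n - k)" if "k < m" for k
    using many[OF that] cap by simp
  show ?thesis
  proof (rule runs_Seq, rule runs_weaken[OF runs_pick_all order.refl])
    fix s assume s: "picks_state (input_state n m P) ((cap - 2) * n) s"
    have "runs run_auction (n * Suc n * Suc (n * Suc (5 * n + 4) + 9) + 3)
        (\<lambda>s'. auction_state m s' \<and> s' ''cnt'' 0 0 = m) s"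
      using s by (intro runs_run_auction many') (simp_all add: picks_state_def input_state_def)
    then show "runs run_auction (n * Suc n * Suc (n * Suc (5 * n + 4) + 9) + 3)
        (\<lambda>s. output_matching n s \<subseteq> ?E \<and>
          is_matching n (output_matching n s) \<and> card (output_matching n s) = m) s"
      by (rule runs_weaken[OF _ order.refl]) (use auction_state_output in blast)
  qed
qed

lemma (in round_robin) cost_le_optimum:
  assumes "metric_on ({..<n} <+> {..<n}) d" "consistent n P d" "perfect_matching n Mopt"
    and "cap \<ge> 3" "M \<subseteq> picks ((cap - 2) * n)"
  shows "cost d M \<le> (real cap - 1) * real cap * cost d Mopt"
proof -
  have "cost d M \<le> picks_cost d ((cap - 2) * n)"
    using assms(1,5) by (rule cost_le_picks_cost) simp
  also note picks_cost_le[OF assms(1-4)]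
  finally show ?thesis .
qed

theorem mainTheorem9:
  fixes \<epsilon> :: real
  assumes "0 < \<epsilon>" and "\<epsilon> < 1"
  shows "\<exists>(K::real) > 0. \<exists>(C::real) > 0. \<exists>mech :: profile \<Rightarrow> matching pmf.
    polytime_mechanism (\<lambda>n. nat \<lceil>(1 - \<epsilon>) * real n\<rceil>) mech \<and>
    (\<forall>n\<ge>2. \<forall>P. pref_profile n P \<longrightarrow>
      (\<forall>M\<in>set_pmf (mech P). is_matching n M \<and> card M = nat \<lceil>(1 - \<epsilon>) * real n\<rceil>) \<and>
      measure_pmf.prob (mech P)
        {M. \<forall>d Mopt. metric_on ({..<n} <+> {..<n}) d \<and> consistent n P d \<and>
              is_arg_min (cost d) (perfect_matching n) Mopt \<longrightarrow>
              cost d M \<le> K * (ln (real n))\<^sup>2 * cost d Mopt}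
        \<ge> 1 - real n powr (- C))"
proof -
  define cap where "cap = nat \<lceil>2 / \<epsilon>\<rceil>"
  define m where "m n = nat \<lceil>(1 - \<epsilon>) * real n\<rceil>" for n
  have "2 < 2 / \<epsilon>" using assms by (simp add: field_simps)
  then have cap3: "cap \<ge> 3" using less_nat_ceiling_iff[of 2 "2 / \<epsilon>"] by (simp add: cap_def)
  have cap_ge: "2 / \<epsilon> \<le> real cap" by (simp add: cap_def real_nat_ceiling_ge)
  have many: "2 * n < cap * (n - k)" if "k < m n" for n k
  proof -
    have k: "real k < (1 - \<epsilon>) * real n" using that by (simp add: m_def less_nat_ceiling_iff)
    also have "\<dots> \<le> real n" using assms by (simp add: mult_left_le_one_le)
    finally have "k < n" by simp
    have "2 * real n = 2 / \<epsilon> * (\<epsilon> * real n)" using assms by simp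
    also have "\<dots> < 2 / \<epsilon> * real (n - k)"
      using k \<open>k < n\<close> assms by (intro mult_strict_left_mono) (auto simp: of_nat_diff algebra_simps)
    also have "\<dots> \<le> real cap * real (n - k)" using cap_ge by (intro mult_right_mono) auto
    finally have "real (2 * n) < real (cap * (n - k))"
      by (simp only: of_nat_mult of_nat_numeral)
    then show ?thesis by (simp only: of_nat_less_iff)
  qed
  let ?c = "Seq (pick_all cap) run_auction"
  define p :: "nat poly" where "p = [:cap:] * [:0, 1:] * [:9, 2:] + [:2:] +
    ([:0, 1:] * [:1, 1:] * ([:0, 1:] * [:5, 5:] + [:10:]) + [:3:])"
  \<comment> \<open>Everything is indexed by \<open>length P\<close>, since the mechanism receives
    only the profile and has to recover \<open>n\<close> from it.\<close>
  define good where "good P M \<longleftrightarrow> M \<subseteq> round_robin.picks (length P) cap P ((cap - 2) * length P) \<and>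
    is_matching (length P) M \<and> card M = m (length P)" for P M
  have "\<exists>s t. exec ?c (input_state (length P) (m (length P)) P) (return_pmf (s, t)) \<and>
      t \<le> poly p (length P) \<and> good P (output_matching (length P) s)"
    if "pref_profile (length P) P" for P
  proof -
    interpret round_robin "length P" cap P by unfold_locales fact
    have "runs ?c (poly p (length P)) (\<lambda>s. good P (output_matching (length P) s))
        (input_state (length P) (m (length P)) P)"
      using runs_mechanism[of "m (length P)", OF many] cap3
      by (auto elim!: runs_weaken simp: p_def good_def algebra_simps)
    then show ?thesis unfolding runs_def by blast
  qed
  then obtain S T where run: "\<And>P. pref_profile (length P) P \<Longrightarrow>
      exec ?c (input_state (length P) (m (length P)) P) (return_pmf (S P, T P)) \<and>
      T P \<le> poly p (length P) \<and> good P (output_matching (length P) (S P))"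
    by metis
  have len: "length P = n" if "pref_profile n P" for n P
    using that by (simp add: pref_profile_def)
  define mech where "mech P = return_pmf (output_matching (length P) (S P))" for P
  have "polytime_mechanism m mech"
    unfolding polytime_mechanism_def
  proof (intro exI allI impI)
    fix n P assume P: "pref_profile n P"
    then show "exec ?c (input_state n (m n) P) (return_pmf (S P, T P)) \<and>
        (\<forall>(s, t)\<in>set_pmf (return_pmf (S P, T P)). t \<le> poly p n) \<and>
        mech P = map_pmf (\<lambda>(s, t). output_matching n s) (return_pmf (S P, T P))"
      using run[of P] len[OF P] by (simp add: mech_def)
  qed
  moreover have "(\<forall>M\<in>set_pmf (mech P). is_matching n M \<and> card M = m n) \<and>
      1 - real n powr (- 1) \<le> measure_pmf.prob (mech P)
        {M. \<forall>d Mopt. metric_on ({..<n} <+> {..<n}) d \<and> consistent n P d \<and>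
              is_arg_min (cost d) (perfect_matching n) Mopt \<longrightarrow>
              cost d M \<le> 4 * (real cap)\<^sup>2 * (ln (real n))\<^sup>2 * cost d Mopt}"
    if n: "n \<ge> 2" and P: "pref_profile n P" for n P
  proof -
    interpret round_robin n cap P by unfold_locales fact
    let ?M = "output_matching n (S P)"
    have M: "?M \<subseteq> picks ((cap - 2) * n)" "is_matching n ?M" "card ?M = m n"
      using run[of P] len[OF P] P by (auto simp: good_def)
    have "cost d ?M \<le> 4 * (real cap)\<^sup>2 * (ln (real n))\<^sup>2 * cost d Mopt"
      if d: "metric_on ({..<n} <+> {..<n}) d" "consistent n P d"
        and opt: "is_arg_min (cost d) (perfect_matching n) Mopt" for d Mopt
    proof -
      have perfect: "perfect_matching n Mopt" using opt by (simp add: is_arg_min_def)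
      then have nonneg: "cost d Mopt \<ge> 0"
        unfolding cost_def
        by (intro sum_nonneg) (auto simp: perfect_matching_def is_matching_def intro!: metric_on_nonneg[OF d(1)])
      \<comment> \<open>For \<open>n \<ge> 2\<close> the squared logarithm is at least
        \<open>1 / 4\<close>. The factor 4 in \<open>K\<close> therefore turns the constant bound
        into the required form.\<close>
      have "1 / 2 \<le> ln (2::real)" using ln2_ge_two_thirds by simp
      also have "\<dots> \<le> ln (real n)" using n by simp
      finally have "(1 / 2)\<^sup>2 \<le> (ln (real n))\<^sup>2" by (intro power_mono) auto
      then have ln: "1 \<le> 4 * (ln (real n))\<^sup>2" by (simp add: power2_eq_square)
      have "cost d ?M \<le> (real cap - 1) * real cap * cost d Mopt"
        by (rule cost_le_optimum[OF d perfect cap3 M(1)])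
      also have "\<dots> \<le> (real cap)\<^sup>2 * cost d Mopt"
        using nonneg by (intro mult_right_mono) (auto simp: power2_eq_square algebra_simps)
      also have "\<dots> \<le> (4 * (ln (real n))\<^sup>2) * ((real cap)\<^sup>2 * cost d Mopt)"
        using mult_right_mono[OF ln, of "(real cap)\<^sup>2 * cost d Mopt"] nonneg by simp
      finally show ?thesis by (simp add: mult.assoc mult.left_commute)
    qed
    then show ?thesis
      using M(2,3) by (auto simp: mech_def len[OF P] measure_return_pmf)
  qed
  moreover have "4 * (real cap)\<^sup>2 > 0" using cap3 by simp
  ultimately show ?thesis
    unfolding m_def by (intro exI[of _ "4 * (real cap)\<^sup>2"] conjI exI[of _ 1] exI[of _ mech] allI impI) auto
qed

end
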